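(* Let $\Omega\subset\mathbb{R}^d$ be a bounded domain, let $A\subset\mathbb{N}_0^d$ be a coherent set, and let $1\le p<\infty$ be such that the embedding $W^A_p(\Omega)\hookrightarrow\ell_\infty(\Omega)$ exists. Define $s:=|A|_1$ and assume $s\ge d/p$. If there exists an RKHS $H$ on $\Omega$ with $W^A_p(\Omega)\subset H\subset\ell_\infty(\Omega)$, then we have $$s\ \ge\ (d/p-d/2)_+ + d/2 .$$
   Context: $(r)_+:=\max\{0,r\}$ for $r\in\mathbb{R}$. For $\alpha\in\mathbb{N}_0^d$, $|\alpha|_1:=\alpha_1+\dots+\alpha_d$. A finite non-empty set $A\subset\mathbb{N}_0^d$ is coherent if for all $\alpha\in A$ and all $\beta\in\mathbb{N}_0^d$ with $\beta\le\alpha$ (componentwise) one has $\beta\in A$; and $|A|_1:=\max\{|\alpha|_1:\alpha\in A\}$. For a bounded domain $\Omega\subset\mathbb{R}^d$, a coherent set $A$ and $p\in[1,\infty)$, the Sobolev space of generalized mixed smoothness $W^A_p(\Omega)$ consists of all measurable functions $f:\Omega\to\mathbb{R}$ (modulo equality almost everywhere) whose weak derivatives $\partial_\alpha f$ exist for all $\alpha\in A$ and for which $\|f\|_{W^A_p(\Omega)}:=\sup_{\alpha\in A}\|\partial_\alpha f\|_{L_p(\Omega)}<\infty$. $\ell_\infty(\Omega)$ is the space of all bounded functions $\Omega\to\mathbb{R}$ with the supremum norm. The embedding $W^A_p(\Omega)\hookrightarrow\ell_\infty(\Omega)$ is understood in the usual sense of Sobolev's embedding theorem: every element of $W^A_p(\Omega)$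 has a (unique) bounded continuous representative, with which it is identified, and the resulting linear map into $\ell_\infty(\Omega)$ is continuous; the inclusion $W^A_p(\Omega)\subset H$ is understood with this identification. An RKHS on $\Omega$ is a Hilbert space whose elements are functions $\Omega\to\mathbb{R}$ and for which all evaluation functionals $f\mapsto f(x)$, $x\in\Omega$, are continuous. *)

theory Defs
  imports "HOL-Analysis.Analysis"
begin

text \<open>
  Multi-indices over the coordinate type \<open>'n\<close> are functions \<open>'n \<Rightarrow> nat\<close>; the order \<open>\<le>\<close> on them
  is the componentwise one.
\<close>

definition mi_abs :: "('n::finite \<Rightarrow> nat) \<Rightarrow> nat"
  where "mi_abs \<alpha> = (\<Sum>i\<in>UNIV. \<alpha> i)"

definition coherent :: "('n::finite \<Rightarrow> nat) set \<Rightarrow> bool"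
  where "coherent A \<longleftrightarrow> finite A \<and> A \<noteq> {} \<and> (\<forall>\<alpha>\<in>A. \<forall>\<beta>. \<beta> \<le> \<alpha> \<longrightarrow> \<beta> \<in> A)"

definition mi_set_abs :: "('n::finite \<Rightarrow> nat) set \<Rightarrow> nat"
  where "mi_set_abs A = Max (mi_abs ` A)"

definition partial_deriv :: "'n::finite \<Rightarrow> (real^'n \<Rightarrow> real) \<Rightarrow> real^'n \<Rightarrow> real"
  where "partial_deriv i f x = deriv (\<lambda>t. f (x + t *\<^sub>R axis i 1)) 0"

text \<open>
  The coordinate type carries no order, so some list of coordinates in which each \<open>i\<close> occurs
  \<open>\<alpha> i\<close> times is chosen. For smooth functions, the only ones to which this is applied, the
  result does not depend on the choice.
\<close>

definition multi_deriv :: "('n::finite \<Rightarrow> nat) \<Rightarrow> (real^'n \<Rightarrow> real) \<Rightarrow> real^'n \<Rightarrow> real"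
  where "multi_deriv \<alpha> f = foldr partial_deriv (SOME is. \<forall>i. count_list is i = \<alpha> i) f"

text \<open>
  The iterated partial derivatives of all orders being Frechet differentiable everywhere makes
  all of them continuous, so this is \<open>C\<^sub>c\<^sup>\<infinity>(\<Omega>)\<close>.
\<close>

definition test_functions :: "(real^'n::finite) set \<Rightarrow> (real^'n \<Rightarrow> real) set"
  where "test_functions \<Omega> = {\<phi>.
    (\<forall>is x. foldr partial_deriv is \<phi> differentiable (at x)) \<and>
    compact (closure {x. \<phi> x \<noteq> 0}) \<and> closure {x. \<phi> x \<noteq> 0} \<subseteq> \<Omega>}"

definition locally_integrable_on :: "(real^'n::finite) set \<Rightarrow> (real^'n \<Rightarrow> real) \<Rightarrow> bool"
  where "locally_integrable_on \<Omega> f \<longleftrightarrow>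
    (\<forall>K. compact K \<and> K \<subseteq> \<Omega> \<longrightarrow> set_integrable lebesgue K f)"

definition is_weak_deriv ::
    "(real^'n::finite) set \<Rightarrow> ('n \<Rightarrow> nat) \<Rightarrow> (real^'n \<Rightarrow> real) \<Rightarrow> (real^'n \<Rightarrow> real) \<Rightarrow> bool"
  where "is_weak_deriv \<Omega> \<alpha> f g \<longleftrightarrow>
    locally_integrable_on \<Omega> f \<and> locally_integrable_on \<Omega> g \<and>
    (\<forall>\<phi>\<in>test_functions \<Omega>.
       (LINT x|lebesgue_on \<Omega>. f x * multi_deriv \<alpha> \<phi> x) =
       (-1) ^ mi_abs \<alpha> * (LINT x|lebesgue_on \<Omega>. g x * \<phi> x))"

text \<open>Unique up to equality almost everywhere on \<open>\<Omega>\<close>, hence the choice is immaterial below.\<close>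

definition weak_deriv ::
    "(real^'n::finite) set \<Rightarrow> ('n \<Rightarrow> nat) \<Rightarrow> (real^'n \<Rightarrow> real) \<Rightarrow> real^'n \<Rightarrow> real"
  where "weak_deriv \<Omega> \<alpha> f = (SOME g. is_weak_deriv \<Omega> \<alpha> f g)"

definition Lp_functions :: "(real^'n::finite) set \<Rightarrow> real \<Rightarrow> (real^'n \<Rightarrow> real) set"
  where "Lp_functions \<Omega> p = {f \<in> borel_measurable (lebesgue_on \<Omega>).
    integrable (lebesgue_on \<Omega>) (\<lambda>x. \<bar>f x\<bar> powr p)}"

definition Lp_norm :: "(real^'n::finite) set \<Rightarrow> real \<Rightarrow> (real^'n \<Rightarrow> real) \<Rightarrow> real"
  where "Lp_norm \<Omega> p f = (LINT x|lebesgue_on \<Omega>. \<bar>f x\<bar> powr p) powr (1 / p)"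

text \<open>
  The Sobolev space is represented by its functions rather than by equivalence classes; only the
  values on \<open>\<Omega>\<close> matter. As \<open>A\<close> is finite, the supremum of the \<open>L\<^sub>p\<close> norms is finite iff all
  derivatives are in \<open>L\<^sub>p\<close>.
\<close>

definition sobolev ::
    "(real^'n::finite) set \<Rightarrow> ('n \<Rightarrow> nat) set \<Rightarrow> real \<Rightarrow> (real^'n \<Rightarrow> real) set"
  where "sobolev \<Omega> A p = {f \<in> borel_measurable (lebesgue_on \<Omega>).
    \<forall>\<alpha>\<in>A. \<exists>g. is_weak_deriv \<Omega> \<alpha> f g \<and> g \<in> Lp_functions \<Omega> p}"

definition sobolev_norm ::
    "(real^'n::finite) set \<Rightarrow> ('n \<Rightarrow> nat) set \<Rightarrow> real \<Rightarrow> (real^'n \<Rightarrow> real) \<Rightarrow> real"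
  where "sobolev_norm \<Omega> A p f = (SUP \<alpha>\<in>A. Lp_norm \<Omega> p (weak_deriv \<Omega> \<alpha> f))"

text \<open>A function \<open>\<Omega> \<rightarrow> \<real>\<close> is encoded as a total function that vanishes outside \<open>\<Omega>\<close>.\<close>

definition functions_on :: "'a set \<Rightarrow> ('a \<Rightarrow> real) set"
  where "functions_on X = {f. \<forall>x. x \<notin> X \<longrightarrow> f x = 0}"

definition ell_infty :: "'a set \<Rightarrow> ('a \<Rightarrow> real) set"
  where "ell_infty X = {f \<in> functions_on X. bounded (f ` X)}"

definition sup_norm :: "'a set \<Rightarrow> ('a \<Rightarrow> real) \<Rightarrow> real"
  where "sup_norm X f = (SUP x\<in>X. \<bar>f x\<bar>)"

definition is_cont_rep :: "(real^'n::finite) set \<Rightarrow> (real^'n \<Rightarrow> real) \<Rightarrow> (real^'n \<Rightarrow> real) \<Rightarrow> bool"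
  where "is_cont_rep \<Omega> f g \<longleftrightarrow>
    g \<in> ell_infty \<Omega> \<and> continuous_on \<Omega> g \<and> (AE x in lebesgue_on \<Omega>. g x = f x)"

definition cont_rep :: "(real^'n::finite) set \<Rightarrow> (real^'n \<Rightarrow> real) \<Rightarrow> real^'n \<Rightarrow> real"
  where "cont_rep \<Omega> f = (THE g. is_cont_rep \<Omega> f g)"

text \<open>
  The second conjunct is continuity of \<open>f \<mapsto> cont_rep \<Omega> f\<close> from the Sobolev space to
  \<open>\<ell>\<^sub>\<infinity>(\<Omega>)\<close>, both with their norm distances.
\<close>

definition sobolev_embeds :: "(real^'n::finite) set \<Rightarrow> ('n \<Rightarrow> nat) set \<Rightarrow> real \<Rightarrow> bool"
  where "sobolev_embeds \<Omega> A p \<longleftrightarrow>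
    (\<forall>f\<in>sobolev \<Omega> A p. \<exists>!g. is_cont_rep \<Omega> f g) \<and>
    (\<forall>f\<in>sobolev \<Omega> A p. \<forall>\<epsilon>>0. \<exists>\<delta>>0. \<forall>g\<in>sobolev \<Omega> A p.
       sobolev_norm \<Omega> A p (\<lambda>x. g x - f x) < \<delta> \<longrightarrow>
       sup_norm \<Omega> (\<lambda>x. cont_rep \<Omega> g x - cont_rep \<Omega> f x) < \<epsilon>)"

locale inner_function_space =
  fixes X :: "'a set" and H :: "('a \<Rightarrow> real) set"
    and ip :: "('a \<Rightarrow> real) \<Rightarrow> ('a \<Rightarrow> real) \<Rightarrow> real"
  assumes subset_functions_on: "H \<subseteq> functions_on X"
    and zero_closed: "(\<lambda>x. 0) \<in> H"
    and add_closed: "\<lbrakk>f \<in> H; g \<in> H\<rbrakk> \<Longrightarrow> (\<lambda>x. f x + g x) \<in> H"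
    and scale_closed: "f \<in> H \<Longrightarrow> (\<lambda>x. c * f x) \<in> H"
    and ip_commute: "\<lbrakk>f \<in> H; g \<in> H\<rbrakk> \<Longrightarrow> ip f g = ip g f"
    and ip_add: "\<lbrakk>f \<in> H; g \<in> H; h \<in> H\<rbrakk> \<Longrightarrow> ip (\<lambda>x. f x + g x) h = ip f h + ip g h"
    and ip_scale: "\<lbrakk>f \<in> H; g \<in> H\<rbrakk> \<Longrightarrow> ip (\<lambda>x. c * f x) g = c * ip f g"
    and ip_nonneg: "f \<in> H \<Longrightarrow> 0 \<le> ip f f"
    and ip_eq_zero: "f \<in> H \<Longrightarrow> ip f f = 0 \<longleftrightarrow> f = (\<lambda>x. 0)"
begin

definition ip_norm :: "('a \<Rightarrow> real) \<Rightarrow> real"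
  where "ip_norm f = sqrt (ip f f)"

text \<open>
  The value outside \<open>H\<close> is irrelevant; it is fixed because \<open>Metric_space\<close> demands nonnegativity
  and symmetry for arbitrary arguments.
\<close>

definition ip_dist :: "('a \<Rightarrow> real) \<Rightarrow> ('a \<Rightarrow> real) \<Rightarrow> real"
  where "ip_dist f g = (if f \<in> H \<and> g \<in> H then ip_norm (\<lambda>x. f x - g x) else 0)"

lemma diff_closed: "\<lbrakk>f \<in> H; g \<in> H\<rbrakk> \<Longrightarrow> (\<lambda>x. f x - g x) \<in> H"
  using add_closed[of f "\<lambda>x. (-1) * g x"] scale_closed[of g "-1"] by simp

lemma ip_lincomb:
  assumes "f \<in> H" "g \<in> H"
  shows "ip (\<lambda>x. a * f x + b * g x) (\<lambda>x. a * f x + b * g x)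
           = a\<^sup>2 * ip f f + 2 * a * b * ip f g + b\<^sup>2 * ip g g"
proof -
  let ?h = "\<lambda>x. a * f x + b * g x"
  have af: "(\<lambda>x. a * f x) \<in> H" and bg: "(\<lambda>x. b * g x) \<in> H"
    using assms scale_closed by auto
  then have h: "?h \<in> H" by (rule add_closed)
  have *: "ip ?h k = a * ip f k + b * ip g k" if "k \<in> H" for k
    using ip_add[OF af bg that] ip_scale assms that by simp
  have "ip ?h ?h = a * ip ?h f + b * ip ?h g"
    using *[OF h] ip_commute h assms by simp
  also have "\<dots> = a * (a * ip f f + b * ip f g) + b * (a * ip f g + b * ip g g)"
    using *[OF assms(1)] *[OF assms(2)] ip_commute[OF assms] by simp
  finally show ?thesis by (simp add: power2_eq_square algebra_simps)
qed

lemma ip_Cauchy_Schwarz: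
  assumes "f \<in> H" "g \<in> H"
  shows "ip f g \<le> ip_norm f * ip_norm g"
proof (cases "ip g g = 0")
  case True
  then have "g = (\<lambda>x. 0)" using ip_eq_zero assms by blast
  then have "ip f g = 0"
    using ip_commute[OF assms] ip_scale[OF assms(2) assms(1), of 0] by simp
  then show ?thesis using True by (simp add: ip_norm_def)
next
  case False
  define a where "a = ip g g"
  define b where "b = ip f g"
  have a: "a > 0" using False ip_nonneg[OF assms(2)] by (simp add: a_def)
  have "(\<lambda>x. a * f x + (- b) * g x) \<in> H"
    by (intro add_closed scale_closed assms)
  then have "0 \<le> a\<^sup>2 * ip f f + 2 * a * (- b) * b + (- b)\<^sup>2 * a"
    using ip_nonneg[of "\<lambda>x. a * f x + (- b) * g x"]
    by (simp only: ip_lincomb[OF assms] a_def[symmetric] b_def[symmetric])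
  also have "\<dots> = a * (a * ip f f - b\<^sup>2)"
    by (simp add: power2_eq_square algebra_simps)
  finally have "b\<^sup>2 \<le> ip f f * a" using a by (simp add: zero_le_mult_iff mult.commute)
  then have "sqrt (b\<^sup>2) \<le> sqrt (ip f f * a)" by (rule real_sqrt_le_mono)
  then show ?thesis by (simp add: real_sqrt_mult ip_norm_def a_def b_def)
qed

lemma ip_norm_triangle:
  assumes "f \<in> H" "g \<in> H"
  shows "ip_norm (\<lambda>x. f x + g x) \<le> ip_norm f + ip_norm g"
proof -
  have "ip (\<lambda>x. f x + g x) (\<lambda>x. f x + g x) = ip f f + 2 * ip f g + ip g g"
    using ip_lincomb[OF assms, of 1 1] by simp
  also have "\<dots> \<le> (ip_norm f + ip_norm g)\<^sup>2"
    using ip_Cauchy_Schwarz[OF assms] ip_nonneg assms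
    by (simp add: power2_sum ip_norm_def)
  finally show ?thesis
    unfolding ip_norm_def[of "\<lambda>x. f x + g x"]
    by (rule real_le_lsqrt[rotated]) (simp_all add: ip_norm_def ip_nonneg assms)
qed

sublocale Metric_space H ip_dist
proof
  show "0 \<le> ip_dist f g" for f g
    by (simp add: ip_dist_def ip_norm_def ip_nonneg diff_closed)
  show "ip_dist f g = ip_dist g f" for f g
  proof (cases "f \<in> H \<and> g \<in> H")
    case True
    then have "ip (\<lambda>x. (-1) * (f x - g x)) (\<lambda>x. (-1) * (f x - g x))
             = ip (\<lambda>x. f x - g x) (\<lambda>x. f x - g x)"
      using ip_lincomb[of "\<lambda>x. f x - g x" "\<lambda>x. f x - g x" "-1" 0] diff_closed by simp
    then show ?thesis using True by (simp add: ip_dist_def ip_norm_def)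
  qed (auto simp: ip_dist_def)
  show "ip_dist f g = 0 \<longleftrightarrow> f = g" if "f \<in> H" "g \<in> H" for f g
    using that by (auto simp: ip_dist_def ip_norm_def ip_eq_zero diff_closed fun_eq_iff)
  show "ip_dist f h \<le> ip_dist f g + ip_dist g h" if "f \<in> H" "g \<in> H" "h \<in> H" for f g h
    using that ip_norm_triangle[of "\<lambda>x. f x - g x" "\<lambda>x. g x - h x"]
    by (simp add: ip_dist_def diff_closed)
qed

end

locale rkhs = inner_function_space X H ip
  for X :: "'a set" and H :: "('a \<Rightarrow> real) set"
    and ip :: "('a \<Rightarrow> real) \<Rightarrow> ('a \<Rightarrow> real) \<Rightarrow> real" +
  assumes complete: mcomplete
    and continuous_evaluation: "x \<in> X \<Longrightarrow> continuous_map mtopology euclideanreal (\<lambda>f. f x)"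

end

theory Submission
  imports Defs
begin

text \<open>
  If \<open>p \<le> 2\<close>, the bound is the assumption \<open>s \<ge> d/p\<close>. The content is that \<open>s \<ge> d/2\<close> for every \<open>p\<close>,
  and the reason is the parallelogram law. Place \<open>n\<^sup>d\<close> bumps \<open>f\<^sub>c\<close> of a fixed height on disjoint cubes of
  side about \<open>1/n\<close>. Because the supports are disjoint, a signed sum \<open>\<Sum>\<^sub>c \<epsilon>\<^sub>c f\<^sub>c\<close> has derivatives of order
  at most \<open>s\<close> bounded by a multiple of \<open>n\<^sup>s\<close>, whatever the signs. In a Hilbert space, however,
  the mean of \<open>\<parallel>\<Sum>\<^sub>c \<epsilon>\<^sub>c f\<^sub>c\<parallel>\<^sup>2\<close> over all signs is \<open>\<Sum>\<^sub>c \<parallel>f\<^sub>c\<parallel>\<^sup>2\<close>, which is at least a multiple of \<open>n\<^sup>d\<close> if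
  evaluation at a point where \<open>f\<^sub>c\<close> is large is uniformly bounded. So if the norm of \<open>H\<close> is
  dominated by the smoothness norm, then \<open>n\<^sup>d \<le> const * n\<^bsup>2s\<^esup>\<close> for arbitrarily large \<open>n\<close>.

  Two uniformity statements have to be extracted from the mere inclusion of function spaces. Both
  come from Baire's theorem, in the form \<open>Baire_cover_dense_in_ball\<close>.

  \<^item> The norms of the evaluation functionals are bounded by some \<open>N\<close> on a dense subset of some
    ball in \<open>\<Omega>\<close>. All bumps are placed in a cube inside this ball. As the bumps are continuous,
    density suffices to find a point at which both the bump and the evaluation are controlled.
  \<^item> Instead of making the smooth functions into a Banach space, the signed sums at the scales
    \<open>n = 16\<^sup>k\<close> are normalised to functions \<open>G\<^sub>k\<close> with derivatives \<open>O(2\<^bsup>-k\<^esup>)\<close>. Then \<open>\<Sum>\<^sub>k t\<^sub>k G\<^sub>k\<close> is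
    smooth for every bounded sequence \<open>t\<close>, hence belongs to \<open>H\<close>, and the closed graph theorem for
    maps from a Banach space into an RKHS (\<open>rkhs.closed_graph\<close>) bounds \<open>\<parallel>G\<^sub>k\<parallel>\<close> uniformly in \<open>k\<close>. If
    \<open>2s < d\<close>, this contradicts the lower bound from the parallelogram law, which grows like \<open>2\<^sup>k\<close>.

  The link to the Sobolev space is that it contains the functions with continuous
  classical derivatives \<open>\<partial>\<^sub>\<beta>\<close>, \<open>\<beta> \<in> A\<close>, vanishing outside \<open>\<Omega>\<close> (\<open>jet_imp_sobolev\<close>).
\<close>

section \<open>Hilbert spaces of functions\<close>

text \<open>
  Baire's theorem for covers of an open set \<open>U\<close> by sets that need not be closed: closing up both
  the pieces and \<open>U\<close> gives closed sets whose union has non-empty interior.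
\<close>

lemma Baire_cover_dense_in_ball:
  fixes C :: "nat \<Rightarrow> 'a::complete_space set"
  assumes "open U" "U \<noteq> {}" "U \<subseteq> (\<Union>n. C n)"
  obtains n x r where "r > 0" "ball x r \<subseteq> U" "ball x r \<subseteq> closure (C n)"
proof -
  have "\<exists>n. interior (closure (C n) \<inter> closure U) \<noteq> {}"
  proof (rule ccontr)
    assume none: "\<not> (\<exists>n. interior (closure (C n) \<inter> closure U) \<noteq> {})"
    have "Met_TC.mtopology interior_of \<Union> (range (\<lambda>n. closure (C n) \<inter> closure U)) = {}"
    proof (rule Met_TC.metric_Baire_category_alt)
      show "Met_TC.mcomplete TYPE('a)"
        unfolding mcomplete_iff_complete by (rule complete_UNIV)
      fix T assume "T \<in> range (\<lambda>n. closure (C n) \<inter> closure U)"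
      then obtain n where T: "T = closure (C n) \<inter> closure U" by (elim rangeE)
      have "closed T" unfolding T by (intro closed_Int closed_closure)
      moreover have "interior T = {}" using none unfolding T by metis
      ultimately
      show "closedin Met_TC.mtopology T \<and> Met_TC.mtopology interior_of T = {}"
        unfolding closedin_mtopology_eq_closed
        unfolding mtopology_is_euclidean euclidean_interior_of by (rule conjI)
    qed (rule countable_image[OF countableI_type])
    then have "interior (\<Union> (range (\<lambda>n. closure (C n) \<inter> closure U))) = {}"
      by simp
    moreover have "U \<subseteq> (\<Union> (range (\<lambda>n. closure (C n) \<inter> closure U)))"
    proof
      fix y assume "y \<in> U"
      then obtain n where "y \<in> C n" using assms(3) by blast
      then have "y \<in> closure (C n) \<inter> closure U"
        using \<open>y \<in> U\<close> closure_subset by (auto dest: subsetD)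
      then show "y \<in> (\<Union> (range (\<lambda>n. closure (C n) \<inter> closure U)))" by blast
    qed
    ultimately show False using assms(1,2) interior_maximal by blast
  qed
  then obtain n where n: "interior (closure (C n) \<inter> closure U) \<noteq> {}" by blast
  define V where "V = interior (closure (C n) \<inter> closure U)"
  have V: "open V" "V \<subseteq> closure (C n)" "V \<subseteq> closure U" "V \<noteq> {}"
    using n interior_subset by (auto simp: V_def)
  then have "V \<inter> U \<noteq> {}" by (metis open_Int_closure_eq_empty inf.orderE)
  then obtain x where "x \<in> V \<inter> U" by blast
  moreover have "open (V \<inter> U)" using V assms by blast
  ultimately obtain r where "r > 0" "ball x r \<subseteq> V \<inter> U"
    using open_contains_ball by blast
  then show thesis using that V by blast
qed

context inner_function_space
begin

lemma sum_closed: "(\<And>i. i \<in> I \<Longrightarrow> f i \<in> H) \<Longrightarrow> (\<lambda>x. \<Sum>i\<in>I. f i x) \<in> H"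
  by (induction I rule: infinite_finite_induct) (auto intro: add_closed zero_closed)

lemma ip_norm_nonneg: "f \<in> H \<Longrightarrow> 0 \<le> ip_norm f"
  by (simp add: ip_norm_def ip_nonneg)

lemma ip_norm_power2: "f \<in> H \<Longrightarrow> (ip_norm f)\<^sup>2 = ip f f"
  by (simp add: ip_norm_def ip_nonneg)

lemma ip_norm_zero: "ip_norm (\<lambda>x. 0) = 0"
  using ip_eq_zero zero_closed by (simp add: ip_norm_def)

lemma ip_norm_scale:
  assumes "f \<in> H" shows "ip_norm (\<lambda>x. c * f x) = \<bar>c\<bar> * ip_norm f"
  using ip_lincomb[OF assms assms, of c 0]
  by (simp add: ip_norm_def real_sqrt_mult)

lemma ip_norm_sum:
  assumes "finite I" "\<And>i. i \<in> I \<Longrightarrow> f i \<in> H"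
  shows "ip_norm (\<lambda>x. \<Sum>i\<in>I. f i x) \<le> (\<Sum>i\<in>I. ip_norm (f i))"
  using assms
proof (induction rule: finite_induct)
  case (insert i I)
  then show ?case
    using ip_norm_triangle[of "f i" "\<lambda>x. \<Sum>i\<in>I. f i x"] sum_closed[of I f] by fastforce
qed (simp add: ip_norm_zero)

text \<open>
  This is the parallelogram law in the form in which Hilbert spaces have type 2. Adding
  one vector at a time, its sign is chosen such that the cross term is non-negative.
\<close>

lemma exists_signs_ip_sum:
  assumes "finite I" "\<And>i. i \<in> I \<Longrightarrow> f i \<in> H"
  obtains \<epsilon> :: "'b \<Rightarrow> real" where "\<And>i. \<bar>\<epsilon> i\<bar> = 1"
    "(\<Sum>i\<in>I. (ip_norm (f i))\<^sup>2) \<le> (ip_norm (\<lambda>x. \<Sum>i\<in>I. \<epsilon> i * f i x))\<^sup>2"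
proof -
  have "\<exists>\<epsilon> :: 'b \<Rightarrow> real. (\<forall>i. \<bar>\<epsilon> i\<bar> = 1) \<and>
    (\<Sum>i\<in>I. ip (f i) (f i)) \<le> ip (\<lambda>x. \<Sum>i\<in>I. \<epsilon> i * f i x) (\<lambda>x. \<Sum>i\<in>I. \<epsilon> i * f i x)"
    using assms
  proof (induction rule: finite_induct)
    case empty
    then show ?case using ip_nonneg[OF zero_closed] by (auto intro!: exI[of _ "\<lambda>_. 1"])
  next
    case (insert i I)
    then obtain \<epsilon> :: "'b \<Rightarrow> real" where \<epsilon>: "\<forall>i. \<bar>\<epsilon> i\<bar> = 1"
      "(\<Sum>i\<in>I. ip (f i) (f i)) \<le> ip (\<lambda>x. \<Sum>i\<in>I. \<epsilon> i * f i x) (\<lambda>x. \<Sum>i\<in>I. \<epsilon> i * f i x)"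
      by auto
    define g where "g = (\<lambda>x. \<Sum>i\<in>I. \<epsilon> i * f i x)"
    have g: "g \<in> H" and fi: "f i \<in> H"
      using insert.prems by (auto simp: g_def intro!: sum_closed scale_closed)
    \<comment> \<open>this sign makes the cross term \<open>2 * \<sigma> * ip (f i) g\<close> non-negative\<close>
    define \<sigma> :: real where "\<sigma> = (if ip (f i) g \<ge> 0 then 1 else -1)"
    have "ip (\<lambda>x. \<sigma> * f i x + 1 * g x) (\<lambda>x. \<sigma> * f i x + 1 * g x)
        = ip (f i) (f i) + 2 * \<sigma> * ip (f i) g + ip g g"
      using ip_lincomb[OF fi g, of \<sigma> 1] by (simp add: \<sigma>_def)
    moreover have "\<sigma> * ip (f i) g \<ge> 0" by (auto simp: \<sigma>_def)
    ultimately have "ip (f i) (f i) + ip g g \<le> ip (\<lambda>x. \<sigma> * f i x + g x) (\<lambda>x. \<sigma> * f i x + g x)"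
      by simp
    moreover have "(\<lambda>x. \<sigma> * f i x + g x) = (\<lambda>x. \<Sum>j\<in>insert i I. (\<epsilon>(i := \<sigma>)) j * f j x)"
      using insert.hyps by (auto simp: g_def fun_eq_iff intro!: sum.cong)
    ultimately have "(\<Sum>j\<in>insert i I. ip (f j) (f j)) \<le>
      ip (\<lambda>x. \<Sum>j\<in>insert i I. (\<epsilon>(i := \<sigma>)) j * f j x) (\<lambda>x. \<Sum>j\<in>insert i I. (\<epsilon>(i := \<sigma>)) j * f j x)"
      using \<epsilon>(2) insert.hyps by (simp flip: g_def)
    moreover have "\<forall>j. \<bar>(\<epsilon>(i := \<sigma>)) j\<bar> = 1" using \<epsilon>(1) by (auto simp: \<sigma>_def)
    ultimately show ?case by blast
  qed
  then obtain \<epsilon> :: "'b \<Rightarrow> real" where \<epsilon>: "\<forall>i. \<bar>\<epsilon> i\<bar> = 1"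
      "(\<Sum>i\<in>I. ip (f i) (f i)) \<le> ip (\<lambda>x. \<Sum>i\<in>I. \<epsilon> i * f i x) (\<lambda>x. \<Sum>i\<in>I. \<epsilon> i * f i x)"
    by auto
  have "(\<lambda>x. \<Sum>i\<in>I. \<epsilon> i * f i x) \<in> H"
    using assms by (auto intro!: sum_closed scale_closed)
  then show thesis using that[of \<epsilon>] \<epsilon> assms by (simp add: ip_norm_power2)
qed

end

context rkhs
begin

lemma evaluation_bounded:
  assumes "x \<in> X"
  obtains C where "\<And>f. f \<in> H \<Longrightarrow> \<bar>f x\<bar> \<le> C * ip_norm f"
proof -
  obtain \<delta> where \<delta>: "\<delta> > 0" "\<And>f. f \<in> H \<Longrightarrow> ip_dist (\<lambda>x. 0) f < \<delta> \<Longrightarrow> dist 0 (f x) < 1"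
    using continuous_evaluation[OF assms] zero_closed
    unfolding mtopology_is_euclidean[symmetric]
      metric_continuous_map[OF Met_TC.Metric_space_axioms]
    by (metis zero_less_one)
  have small: "\<bar>f x\<bar> < 1" if "f \<in> H" "ip_norm f < \<delta>" for f
    using \<delta>(2)[of f] that zero_closed ip_norm_scale[of f "-1"] by (simp add: ip_dist_def)
  have "\<bar>f x\<bar> \<le> 2 / \<delta> * ip_norm f" if f: "f \<in> H" for f
  proof (cases "ip_norm f = 0")
    case True
    then have "f = (\<lambda>x. 0)" using f ip_eq_zero by (simp add: ip_norm_def)
    then show ?thesis using True by simp
  next
    case False
    then have pos: "ip_norm f > 0" using ip_norm_nonneg[OF f] by simp
    have "ip_norm (\<lambda>x. \<delta> / (2 * ip_norm f) * f x) < \<delta>"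
      unfolding ip_norm_scale[OF f] using pos \<delta>(1) by simp
    then have "\<bar>\<delta> / (2 * ip_norm f) * f x\<bar> < 1"
      by (rule small[OF scale_closed[OF f]])
    then show ?thesis using pos \<delta>(1) by (simp add: abs_mult field_simps)
  qed
  then show thesis using that by blast
qed

text \<open>
  Absolutely convergent series converge in \<open>H\<close> by completeness, and as evaluations are continuous
  the limit in \<open>H\<close> is the pointwise sum. So the norm is countably subadditive with respect to
  pointwise convergence, as the closed graph theorem below requires.
\<close>

lemma absolutely_convergent_series:
  assumes "\<And>n. f n \<in> H" "summable (\<lambda>n. ip_norm (f n))"
    and lim: "\<And>x. x \<in> X \<Longrightarrow> (\<lambda>n. f n x) sums h x" and h: "h \<in> functions_on X"
  shows "h \<in> H" "ip_norm h \<le> (\<Sum>n. ip_norm (f n))"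
proof -
  define S where "S N = (\<lambda>x. \<Sum>n<N. f n x)" for N
  have S: "S N \<in> H" for N using assms(1) by (auto simp: S_def intro: sum_closed)
  define t where "t N = (\<Sum>n<N. ip_norm (f n))" for N
  have mono_bound: "ip_dist (S m) (S n) \<le> t n - t m" if "m \<le> n" for m n
  proof -
    have set: "{..<n} = {..<m} \<union> {m..<n}" using that by auto
    have "(\<lambda>x. S n x - S m x) = (\<lambda>x. \<Sum>k\<in>{m..<n}. f k x)"
      unfolding S_def set by (subst sum.union_disjoint) auto
    then have "ip_dist (S n) (S m) \<le> (\<Sum>k\<in>{m..<n}. ip_norm (f k))"
      using S assms(1) by (simp add: ip_dist_def ip_norm_sum)
    also have "\<dots> = t n - t m"
      unfolding t_def set by (subst sum.union_disjoint) auto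
    finally show ?thesis by (simp add: commute)
  qed
  have "t \<longlonglongrightarrow> (\<Sum>n. ip_norm (f n))"
    unfolding t_def using assms(2) by (rule summable_LIMSEQ)
  then have "Cauchy t" by (rule LIMSEQ_imp_Cauchy)
  have dist_t: "ip_dist (S m) (S n) \<le> dist (t m) (t n)" for m n
    using mono_bound[of m n] mono_bound[of n m] by (cases "m \<le> n") (auto simp: dist_real_def commute)
  have "MCauchy S"
    unfolding MCauchy_def
  proof (intro conjI allI impI)
    fix e :: real assume "e > 0"
    then obtain M where "\<forall>m\<ge>M. \<forall>n\<ge>M. dist (t m) (t n) < e"
      using \<open>Cauchy t\<close> unfolding Cauchy_def by blast
    then show "\<exists>N. \<forall>n n'. N \<le> n \<longrightarrow> N \<le> n' \<longrightarrow> ip_dist (S n) (S n') < e"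
      using dist_t order.strict_trans1 by blast
  qed (use S in auto)
  then obtain g where g: "limitin mtopology S g sequentially"
    using complete by (auto simp: mcomplete_def)
  have gH: "g \<in> H" using g by (simp add: limitin_mspace)
  have "g x = h x" for x
  proof (cases "x \<in> X")
    case True
    have "(\<lambda>n. S n x) \<longlonglongrightarrow> g x"
      using continuous_map_limit[OF continuous_evaluation[OF True] g] by (simp add: o_def comp_def)
    moreover have "(\<lambda>n. S n x) \<longlonglongrightarrow> h x"
      using lim[OF True] by (simp add: S_def sums_def)
    ultimately show ?thesis by (rule LIMSEQ_unique)
  next
    case False
    then show ?thesis using gH h subset_functions_on by (auto simp: functions_on_def)
  qed
  then have gh: "g = h" by auto
  show "h \<in> H" using gH gh by simp
  have "(\<lambda>n. ip_dist (S n) g) \<longlonglongrightarrow> 0"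
    using g unfolding limit_metric_sequentially LIMSEQ_def dist_real_def
    by (metis abs_of_nonneg diff_zero nonneg)
  then have "(\<lambda>n. ip_dist (S n) g + (\<Sum>n. ip_norm (f n))) \<longlonglongrightarrow> 0 + (\<Sum>n. ip_norm (f n))"
    by (intro tendsto_intros)
  moreover have "ip_norm g \<le> ip_dist (S n) g + (\<Sum>n. ip_norm (f n))" for n
  proof -
    have "ip_norm g \<le> ip_norm (\<lambda>x. g x - S n x) + ip_norm (S n)"
      using ip_norm_triangle[of "\<lambda>x. g x - S n x" "S n"] S gH by (simp add: diff_closed)
    moreover have "ip_norm (S n) \<le> t n"
      unfolding S_def t_def using assms(1) by (intro ip_norm_sum) auto
    moreover have "t n \<le> (\<Sum>n. ip_norm (f n))"
      unfolding t_def using assms ip_norm_nonneg by (intro sum_le_suminf) auto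
    moreover have "ip_norm (\<lambda>x. g x - S n x) = ip_dist (S n) g"
      using S gH by (subst commute) (simp add: ip_dist_def)
    ultimately show ?thesis by linarith
  qed
  ultimately show "ip_norm h \<le> (\<Sum>n. ip_norm (f n))"
    unfolding gh[symmetric] by (intro LIMSEQ_le_const[where X = "\<lambda>n. ip_dist (S n) g + (\<Sum>n. ip_norm (f n))"]) auto
qed

text \<open>
  The graph of such a \<open>T\<close> is closed because convergence in \<open>H\<close> implies pointwise convergence. The
  proof follows Zabreiko: the seminorm \<open>q t = \<parallel>T t\<parallel>\<close> is countably subadditive. By Baire's theorem
  some set \<open>{q \<le> N}\<close> is dense in a ball, so that each small \<open>t\<close> is the sum of a series \<open>u n\<close> with
  \<open>q (u n) \<le> 2 * N / 2 ^ n\<close>, and hence \<open>q t \<le> 4 * N\<close>.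
\<close>

lemma closed_graph:
  fixes T :: "'b::banach \<Rightarrow> 'a \<Rightarrow> real"
  assumes T: "\<And>t. T t \<in> H"
    and lin: "\<And>x. x \<in> X \<Longrightarrow> bounded_linear (\<lambda>t. T t x)"
  obtains C where "\<And>t. ip_norm (T t) \<le> C * norm t"
proof -
  have out: "T t x = 0" if "x \<notin> X" for t x
    using T[of t] that subset_functions_on by (auto simp: functions_on_def)
  have T_add: "T (s + t) = (\<lambda>x. T s x + T t x)" for s t
  proof
    show "T (s + t) x = T s x + T t x" for x
      using linear_simps(1)[OF lin] out by (cases "x \<in> X") auto
  qed
  have T_scale: "T (c *\<^sub>R t) = (\<lambda>x. c * T t x)" for c t
  proof
    show "T (c *\<^sub>R t) x = c * T t x" for x
      using linear_simps(5)[OF lin] out by (cases "x \<in> X") auto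
  qed
  define q where "q t = ip_norm (T t)" for t
  have q_add: "q (s + t) \<le> q s + q t" for s t
    using ip_norm_triangle[OF T T, of s t] by (simp add: q_def T_add)
  have q_scale: "q (c *\<^sub>R t) = \<bar>c\<bar> * q t" for c t
    using ip_norm_scale[OF T] by (simp add: q_def T_scale)
  have q_minus: "q (- t) = q t" for t
    using q_scale[of "-1" t] by simp
  have q_nonneg: "q t \<ge> 0" for t by (simp add: q_def T ip_norm_nonneg)
  have q_series: "q t \<le> (\<Sum>n. q (u n))" if "u sums t" "summable (\<lambda>n. q (u n))" for u t
    unfolding q_def
  proof (rule absolutely_convergent_series)
    show "(\<lambda>n. T (u n) x) sums T t x" if "x \<in> X" for x
      using bounded_linear.sums[OF lin[OF that] \<open>u sums t\<close>] .
  qed (use T that subset_functions_on in \<open>auto simp: q_def\<close>)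
  have "UNIV \<subseteq> (\<Union>n. {t. q t \<le> real n})"
    using real_arch_simple by auto
  then obtain N x r where r: "r > 0" "ball x r \<subseteq> closure {t. q t \<le> real N}"
    by (metis Baire_cover_dense_in_ball[OF open_UNIV UNIV_not_empty])
  \<comment> \<open>subtracting an approximation of the centre moves the ball to the origin\<close>
  have near: "\<exists>u. q u \<le> 2 * real N \<and> norm (t - u) < e" if "norm t < r" "e > 0" for t e
  proof -
    have "x \<in> closure {t. q t \<le> real N}" "x + t \<in> closure {t. q t \<le> real N}"
      using r that by (auto simp: dist_norm subset_iff)
    then obtain v w where vw: "q v \<le> real N" "dist v x < e / 2" "q w \<le> real N" "dist w (x + t) < e / 2"
      using \<open>e > 0\<close> by (metis closure_approachable half_gt_zero mem_Collect_eq)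
    have "q (w - v) \<le> 2 * real N"
      using q_add[of w "- v"] q_minus[of v] vw by simp
    moreover have "norm (t - (w - v)) < e"
    proof -
      have "t - (w - v) = (v - x) - (w - (x + t))" by simp
      then have "norm (t - (w - v)) \<le> norm (v - x) + norm (w - (x + t))"
        by (metis norm_triangle_ineq4)
      then show ?thesis using vw by (simp add: dist_norm)
    qed
    ultimately show ?thesis by blast
  qed
  have step: "\<exists>u. q u \<le> 2 * real N / 2 ^ n \<and> norm (t - u) < r / 2 ^ Suc n" if "norm t < r / 2 ^ n" for t n
  proof -
    have "norm ((2 ^ n) *\<^sub>R t) < r" using that by (simp add: field_simps)
    then obtain u where u: "q u \<le> 2 * real N" "norm ((2 ^ n) *\<^sub>R t - u) < r / 2"
      using near[of "(2 ^ n) *\<^sub>R t" "r / 2"] r by auto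
    have "q (inverse (2 ^ n) *\<^sub>R u) \<le> 2 * real N / 2 ^ n"
      using u(1) by (simp add: q_scale divide_inverse mult.commute mult_right_mono)
    moreover have "t - inverse (2 ^ n) *\<^sub>R u = inverse (2 ^ n) *\<^sub>R ((2 ^ n) *\<^sub>R t - u)"
      by (simp add: algebra_simps)
    then have "norm (t - inverse (2 ^ n) *\<^sub>R u) = norm ((2 ^ n) *\<^sub>R t - u) / 2 ^ n"
      by (simp add: divide_inverse mult.commute)
    then have "norm (t - inverse (2 ^ n) *\<^sub>R u) < r / 2 ^ Suc n"
      using u(2) by (simp add: field_simps)
    ultimately show ?thesis by blast
  qed
  \<comment> \<open>\<open>R n\<close> below is what remains of \<open>t\<close> after \<open>n\<close> rounds of approximation by \<open>step\<close>\<close>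
  define pick where "pick n t = (SOME u. q u \<le> 2 * real N / 2 ^ n \<and> norm (t - u) < r / 2 ^ Suc n)" for n t
  have pick: "q (pick n t) \<le> 2 * real N / 2 ^ n" "norm (t - pick n t) < r / 2 ^ Suc n"
    if "norm t < r / 2 ^ n" for n t
    using someI_ex[OF step[OF that]] by (auto simp: pick_def)
  have small: "q t \<le> 4 * real N" if t: "norm t < r" for t
  proof -
    define R where "R = rec_nat t (\<lambda>n s. s - pick n s)"
    have R0: "R 0 = t" and RS: "R (Suc n) = R n - pick n (R n)" for n by (simp_all add: R_def)
    have normR: "norm (R n) < r / 2 ^ n" for n
      by (induction n) (use t pick(2) in \<open>auto simp: R0 RS\<close>)
    define u where "u n = pick n (R n)" for n
    have "(\<Sum>n<m. u n) = t - R m" for m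
      by (induction m) (auto simp: R0 RS u_def)
    moreover have "R \<longlonglongrightarrow> 0"
    proof (rule Lim_null_comparison)
      show "\<forall>\<^sub>F n in sequentially. norm (R n) \<le> r * (1/2) ^ n"
        using normR by (auto intro!: always_eventually less_imp_le simp: power_divide)
      show "(\<lambda>n. r * (1/2) ^ n) \<longlonglongrightarrow> 0"
        by (intro tendsto_mult_right_zero LIMSEQ_power_zero) auto
    qed
    then have "(\<lambda>m. t - R m) \<longlonglongrightarrow> t - 0" by (intro tendsto_intros)
    ultimately have sums: "u sums t" by (simp add: sums_def)
    have bound: "q (u n) \<le> 2 * real N * (1/2) ^ n" for n
      using pick(1)[OF normR] by (simp add: u_def power_divide)
    have geo: "(\<lambda>n. 2 * real N * (1/2) ^ n) sums (2 * real N * 2)"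
      using geometric_sums[of "1/2::real"] by (intro sums_mult) simp
    have "summable (\<lambda>n. q (u n))"
      by (rule summable_comparison_test'[OF sums_summable[OF geo], of 0]) (use bound q_nonneg in auto)
    then have "q t \<le> (\<Sum>n. q (u n))" and "(\<Sum>n. q (u n)) \<le> 2 * real N * 2"
      using q_series[OF sums] bound sums_le[OF _ summable_sums geo] by auto
    then show ?thesis by simp
  qed
  \<comment> \<open>scaling \<open>t\<close> to norm \<open>r / 2\<close> brings it strictly inside the ball\<close>
  have "q t \<le> 8 * real N / r * norm t" for t
  proof (cases "t = 0")
    case True
    then show ?thesis using q_scale[of 0 t] by simp
  next
    case False
    have "q ((r / (2 * norm t)) *\<^sub>R t) \<le> 4 * real N"
      by (rule small) (use False r in auto)
    then show ?thesis using False r by (simp add: q_scale field_simps)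
  qed
  then show thesis unfolding q_def by (rule that)
qed

end

section \<open>Classical derivatives are weak derivatives\<close>

lemma integrable_continuous_bounded_support:
  fixes f :: "'a::euclidean_space \<Rightarrow> real"
  assumes "continuous_on UNIV f" "bounded {x. f x \<noteq> 0}"
  shows "integrable lborel f"
proof -
  let ?K = "closure {x. f x \<noteq> 0}"
  have "integrable lborel (\<lambda>x. indicator ?K x *\<^sub>R f x)"
    using assms by (intro borel_integrable_compact continuous_on_subset[OF assms(1)]) auto
  moreover have "(\<lambda>x. indicator ?K x *\<^sub>R f x) = f"
    using closure_subset[of "{x. f x \<noteq> 0}"] by (auto simp: indicator_def fun_eq_iff)
  ultimately show ?thesis by simp
qed

text \<open>
  Lebesgue measure is translation invariant, so every difference quotient of \<open>w\<close> has integral zero.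
  The difference quotients along \<open>e\<close> are bounded by the mean value theorem and supported in a fixed
  compact set, so dominated convergence carries this over to the derivative.
\<close>

lemma integral_directional_derivative_eq_0:
  fixes w w' :: "'a::euclidean_space \<Rightarrow> real"
  assumes w: "continuous_on UNIV w" and w': "continuous_on UNIV w'"
    and deriv: "\<And>x. ((\<lambda>t. w (x + t *\<^sub>R e)) has_real_derivative w' x) (at 0)"
    and bdd: "bounded {x. w x \<noteq> 0}"
  shows "(LINT x|lborel. w' x) = 0"
proof -
  obtain R where R: "R > 0" "\<And>x. w x \<noteq> 0 \<Longrightarrow> norm x \<le> R"
    using bdd unfolding bounded_pos by blast
  \<comment> \<open>\<open>K\<close> contains the support of every translate of \<open>w\<close> by \<open>t *\<^sub>R e\<close> with \<open>\<bar>t\<bar> \<le> 1\<close>\<close>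
  define K where "K = cball (0::'a) (R + norm e)"
  have K: "compact K" by (simp add: K_def)
  have zero: "w (x + t *\<^sub>R e) = 0" if "x \<notin> K" "\<bar>t\<bar> \<le> 1" for x t
  proof (rule ccontr)
    assume "w (x + t *\<^sub>R e) \<noteq> 0"
    then have "norm (x + t *\<^sub>R e) \<le> R" by (rule R(2))
    moreover have "norm x \<le> norm (x + t *\<^sub>R e) + norm (t *\<^sub>R e)"
      by (metis add_diff_cancel norm_triangle_ineq4)
    moreover have "norm (t *\<^sub>R e) \<le> norm e"
      using that(2) by (simp add: mult_left_le_one_le)
    ultimately show False using that(1) by (simp add: K_def)
  qed
  have deriv': "((\<lambda>t. w (x + t *\<^sub>R e)) has_real_derivative w' (x + t *\<^sub>R e)) (at t)" for x t
  proof -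
    have "((\<lambda>u. w ((x + t *\<^sub>R e) + u *\<^sub>R e)) has_real_derivative w' (x + t *\<^sub>R e)) (at (t - t))"
      using deriv[of "x + t *\<^sub>R e"] by simp
    then have "((\<lambda>s. w ((x + t *\<^sub>R e) + (s - t) *\<^sub>R e)) has_real_derivative w' (x + t *\<^sub>R e) * 1) (at t)"
      by (rule DERIV_chain2) (auto intro!: derivative_eq_intros)
    moreover have "(x + t *\<^sub>R e) + (s - t) *\<^sub>R e = x + s *\<^sub>R e" for s
      by (simp add: algebra_simps)
    ultimately show ?thesis by simp
  qed
  have "bounded (w' ` cball 0 (R + 2 * norm e))"
    by (intro compact_imp_bounded compact_continuous_image continuous_on_subset[OF w']) auto
  then obtain M where M: "\<And>x. x \<in> cball 0 (R + 2 * norm e) \<Longrightarrow> \<bar>w' x\<bar> \<le> M"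
    unfolding bounded_iff by (metis imageI real_norm_def)
  define D where "D n x = (w (x + inverse (real (Suc n)) *\<^sub>R e) - w x) / inverse (real (Suc n))" for n x
  have D_bound: "norm (D n x) \<le> M * indicator K x" for n x
  proof (cases "x \<in> K")
    case True
    define h where "h = inverse (real (Suc n))"
    have h: "0 < h" "h \<le> 1" by (auto simp: h_def field_simps)
    have "\<exists>z. z > 0 \<and> z < h \<and> w (x + h *\<^sub>R e) - w (x + 0 *\<^sub>R e) = (h - 0) * w' (x + z *\<^sub>R e)"
      by (rule MVT2[OF h(1)]) (rule deriv')
    then obtain z where z: "0 < z" "z < h" "w (x + h *\<^sub>R e) - w x = h * w' (x + z *\<^sub>R e)" by auto
    have "norm (z *\<^sub>R e) \<le> norm e" using z h by (simp add: mult_left_le_one_le)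
    then have "norm (x + z *\<^sub>R e) \<le> R + 2 * norm e"
      using True norm_triangle_ineq[of x "z *\<^sub>R e"] by (simp add: K_def)
    then have "\<bar>w' (x + z *\<^sub>R e)\<bar> \<le> M" by (intro M) simp
    moreover have "D n x = w' (x + z *\<^sub>R e)"
      unfolding D_def h_def[symmetric] z(3) using h by simp
    ultimately show ?thesis using True by simp
  next
    case False
    then show ?thesis using zero[of x 0] zero[of x "inverse (real (Suc n))"]
      by (simp add: D_def inverse_le_1_iff)
  qed
  have D_lim: "(\<lambda>n. D n x) \<longlonglongrightarrow> w' x" for x
  proof -
    have "((\<lambda>t. (w (x + t *\<^sub>R e) - w x) / t) \<longlongrightarrow> w' x) (at 0)"
      using deriv[of x] by (simp add: DERIV_def)
    moreover have "filterlim (\<lambda>n. inverse (real (Suc n))) (at 0) sequentially"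
      using LIMSEQ_inverse_real_of_nat by (simp add: filterlim_at del: of_nat_Suc)
    ultimately show ?thesis
      unfolding D_def by (rule filterlim_compose)
  qed
  have int_w: "integrable lborel w"
    using w bdd by (rule integrable_continuous_bounded_support)
  have shift: "integrable lborel (\<lambda>x. w (x + c))" "(LINT x|lborel. w (x + c)) = (LINT x|lborel. w x)" for c
  proof -
    have [measurable]: "w \<in> borel_measurable borel"
      using w by (rule borel_measurable_continuous_onI)
    show "integrable lborel (\<lambda>x. w (x + c))"
      using int_w integrable_distr[of "(+) c" lborel borel w]
      by (simp add: lborel_distr_plus add.commute)
    show "(LINT x|lborel. w (x + c)) = (LINT x|lborel. w x)"
      using integral_distr[of "(+) c" lborel borel w]
      by (simp add: lborel_distr_plus add.commute)
  qed
  have "(\<lambda>n. LINT x|lborel. D n x) \<longlonglongrightarrow> (LINT x|lborel. w' x)"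
  proof (rule integral_dominated_convergence[where w = "\<lambda>x. M * indicator K x"])
    show "w' \<in> borel_measurable lborel"
      using w' by (simp add: borel_measurable_continuous_onI)
    show "D n \<in> borel_measurable lborel" for n
      unfolding D_def using shift(1) int_w by measurable
    show "integrable lborel (\<lambda>x. M * indicat_real K x)"
      using emeasure_lborel_cball_finite[of "0::'a" "R + norm e"]
      by (intro integrable_mult_right integrable_real_indicator) (auto simp: K_def)
  qed (use D_lim D_bound in auto)
  moreover have "(LINT x|lborel. D n x) = 0" for n
    unfolding D_def using shift int_w by simp
  ultimately show ?thesis
    by (simp add: LIMSEQ_const_iff)
qed

lemma partial_deriv_has_derivative:
  assumes "f differentiable (at x)"
  shows "((\<lambda>t. f (x + t *\<^sub>R axis i 1)) has_real_derivative partial_deriv i f x) (at 0)"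
proof -
  obtain f' where "(f has_derivative f') (at (x + 0 *\<^sub>R axis i 1))"
    using assms by (auto simp: differentiable_def)
  moreover have "((\<lambda>t. x + t *\<^sub>R axis i 1) has_derivative (\<lambda>t. t *\<^sub>R axis i (1::real))) (at 0)"
    by (auto intro!: derivative_eq_intros)
  ultimately have "((\<lambda>t. f (x + t *\<^sub>R axis i 1)) has_derivative (\<lambda>t. f' (t *\<^sub>R axis i 1))) (at 0)"
    by (rule has_derivative_compose[rotated])
  then have "(\<lambda>t. f (x + t *\<^sub>R axis i 1)) differentiable (at 0)"
    by (auto simp: differentiable_def)
  then show ?thesis
    by (simp add: partial_deriv_def DERIV_deriv_iff_real_differentiable)
qed

lemma test_function_derivs_continuous:
  "\<phi> \<in> test_functions \<Omega> \<Longrightarrow> continuous_on UNIV (foldr partial_deriv is \<phi>)"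
  by (intro continuous_at_imp_continuous_on) (auto simp: test_functions_def intro: differentiable_imp_continuous_within)

lemma foldr_partial_deriv_outside_support:
  assumes "x \<notin> closure {x. \<phi> x \<noteq> 0}"
  shows "foldr partial_deriv is \<phi> x = 0"
  using assms
proof (induction "is" arbitrary: x)
  case (Cons i "is")
  let ?S = "closure {x. \<phi> x \<noteq> 0}"
  have "open (- ?S)" by auto
  then obtain r where r: "r > 0" "ball x r \<subseteq> - ?S"
    using Cons.prems open_contains_ball by (metis ComplI)
  have "\<forall>\<^sub>F t in nhds 0. foldr partial_deriv is \<phi> (x + t *\<^sub>R axis i 1) = 0"
    unfolding eventually_nhds_metric
  proof (intro exI[of _ r] conjI allI impI r(1))
    fix t :: real assume "dist t 0 < r"
    then have "x + t *\<^sub>R axis i 1 \<in> ball x r" by (simp add: dist_norm)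
    then show "foldr partial_deriv is \<phi> (x + t *\<^sub>R axis i 1) = 0"
      using r(2) Cons.IH by blast
  qed
  then have "deriv (\<lambda>t. foldr partial_deriv is \<phi> (x + t *\<^sub>R axis i 1)) 0 = deriv (\<lambda>t. 0) 0"
    by (intro deriv_cong_ev) auto
  then show ?case unfolding foldr_Cons comp_apply partial_deriv_def[of i] by simp
next
  case Nil
  then show ?case using subsetD[OF closure_subset[of "{x. \<phi> x \<noteq> 0}"], of x] by auto
qed

text \<open>
  The product \<open>u * \<psi>\<close> has bounded support, so the integral of its partial derivative vanishes.
\<close>

lemma integration_by_parts_partial:
  fixes u u' \<psi> :: "real^'n::finite \<Rightarrow> real"
  assumes u: "continuous_on UNIV u" and u': "continuous_on UNIV u'"
    and deriv: "\<And>x. ((\<lambda>t. u (x + t *\<^sub>R axis i 1)) has_real_derivative u' x) (at 0)"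
    and \<psi>: "\<And>x. \<psi> differentiable (at x)" and \<psi>': "continuous_on UNIV (partial_deriv i \<psi>)"
    and supp: "compact S" "\<And>x. x \<notin> S \<Longrightarrow> \<psi> x = 0" "\<And>x. x \<notin> S \<Longrightarrow> partial_deriv i \<psi> x = 0"
  shows "(LINT x|lborel. u x * partial_deriv i \<psi> x) = - (LINT x|lborel. u' x * \<psi> x)"
proof -
  have cont: "continuous_on UNIV \<psi>"
    using \<psi> by (intro continuous_at_imp_continuous_on) (auto intro: differentiable_imp_continuous_within)
  have int: "integrable lborel (\<lambda>x. u x * partial_deriv i \<psi> x)" "integrable lborel (\<lambda>x. u' x * \<psi> x)"
    using supp by (intro integrable_continuous_bounded_support continuous_intros u u' \<psi>' cont
      bounded_subset[OF compact_imp_bounded[OF supp(1)]]; force)+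
  have "(LINT x|lborel. u' x * \<psi> x + u x * partial_deriv i \<psi> x) = 0"
  proof (rule integral_directional_derivative_eq_0[where w = "\<lambda>x. u x * \<psi> x" and e = "axis i 1"])
    show "((\<lambda>t. u (x + t *\<^sub>R axis i 1) * \<psi> (x + t *\<^sub>R axis i 1)) has_real_derivative
        u' x * \<psi> x + u x * partial_deriv i \<psi> x) (at 0)" for x
      using DERIV_mult[OF deriv[of x] partial_deriv_has_derivative[OF \<psi>, of x i]]
      by (simp add: mult.commute)
    show "bounded {x. u x * \<psi> x \<noteq> 0}"
      using supp by (intro bounded_subset[OF compact_imp_bounded[OF supp(1)]]) force
  qed (intro continuous_intros u u' \<psi>' cont)+
  then show ?thesis using int by simp
qed

text \<open>
  This makes the choice of a list of coordinates in \<open>multi_deriv\<close> well defined.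
\<close>

lemma exists_list_with_counts:
  fixes \<alpha> :: "'n::finite \<Rightarrow> nat"
  shows "\<exists>is. \<forall>i. count_list is i = \<alpha> i"
proof -
  have "count (Abs_multiset \<alpha>) = \<alpha>" by (intro count_Abs_multiset) simp
  then show ?thesis by (metis ex_mset count_mset)
qed

lemma lebesgue_on_integral_of_continuous:
  fixes f :: "'a::euclidean_space \<Rightarrow> real"
  assumes "open \<Omega>" "continuous_on UNIV f" "\<And>x. x \<notin> \<Omega> \<Longrightarrow> f x = 0"
  shows "(LINT x|lebesgue_on \<Omega>. f x) = (LINT x|lborel. f x)"
proof -
  have "(LINT x|lebesgue_on \<Omega>. f x) = (LINT x|lebesgue. indicator \<Omega> x *\<^sub>R f x)"
    using assms(1) by (intro integral_restrict_space) auto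
  also have "\<dots> = (LINT x|lebesgue. f x)"
    using assms(3) by (intro Bochner_Integration.integral_cong) (auto simp: indicator_def)
  also have "\<dots> = (LINT x|lborel. f x)"
    using assms(2) by (intro integral_completion) (simp add: borel_measurable_continuous_onI)
  finally show ?thesis .
qed

lemma continuous_imp_locally_integrable_on:
  fixes f :: "real^'n::finite \<Rightarrow> real"
  assumes "continuous_on UNIV f"
  shows "locally_integrable_on \<Omega> f"
  unfolding locally_integrable_on_def
proof (intro allI impI)
  fix K :: "(real^'n) set" assume K: "compact K \<and> K \<subseteq> \<Omega>"
  then have "integrable lborel (\<lambda>x. indicator K x *\<^sub>R f x)"
    by (intro borel_integrable_compact continuous_on_subset[OF assms]) auto
  then show "set_integrable lebesgue K f"
    unfolding set_integrable_def
    by (subst integrable_completion) (auto dest: borel_measurable_integrable)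
qed

lemma continuous_imp_integrable_lebesgue_on_bounded:
  fixes f :: "real^'n::finite \<Rightarrow> real"
  assumes "open \<Omega>" "bounded \<Omega>" "continuous_on UNIV f"
  shows "integrable (lebesgue_on \<Omega>) f"
proof -
  have "set_integrable lebesgue (closure \<Omega>) f"
    using continuous_imp_locally_integrable_on[OF assms(3), of UNIV] assms(2)
    by (simp add: locally_integrable_on_def compact_closure)
  then have "set_integrable lebesgue \<Omega> f"
    by (rule set_integrable_subset) (use assms(1) closure_subset in auto)
  then show ?thesis
    using assms(1) by (subst integrable_restrict_space) (auto simp: set_integrable_def)
qed

text \<open>
  The family \<open>U\<close> plays the role of the partial derivatives \<open>U \<beta> = \<partial>\<^sub>\<beta> (U 0)\<close>. Integrating by parts along
  the list of coordinates hidden in \<open>multi_deriv\<close> moves one derivative at a time to \<open>U\<close>. As \<open>U\<close> is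
  indexed by multi-indices, every order of the list leads to the same \<open>U \<alpha>\<close>.
\<close>

lemma is_weak_deriv_classical:
  fixes U :: "('n::finite \<Rightarrow> nat) \<Rightarrow> real^'n \<Rightarrow> real"
  assumes \<Omega>: "open \<Omega>"
    and cont: "\<And>\<beta>. \<beta> \<le> \<alpha> \<Longrightarrow> continuous_on UNIV (U \<beta>)"
    and deriv: "\<And>\<beta> i x. \<beta>(i := Suc (\<beta> i)) \<le> \<alpha> \<Longrightarrow>
      ((\<lambda>t. U \<beta> (x + t *\<^sub>R axis i 1)) has_real_derivative U (\<beta>(i := Suc (\<beta> i))) x) (at 0)"
  shows "is_weak_deriv \<Omega> \<alpha> (U (\<lambda>_. 0)) (U \<alpha>)"
proof -
  \<comment> \<open>the induction needs an arbitrary starting index, since each step raises it\<close>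
  have *: "(LINT x|lborel. U \<beta> x * foldr partial_deriv is \<phi> x) =
      (-1) ^ length is * (LINT x|lborel. U (\<lambda>j. \<beta> j + count_list is j) x * \<phi> x)"
    if \<phi>: "\<phi> \<in> test_functions \<Omega>" and "\<And>j. \<beta> j + count_list is j \<le> \<alpha> j" for \<phi> \<beta> "is"
    using that(2)
  proof (induction "is" arbitrary: \<beta>)
    case (Cons i "is")
    define \<psi> where "\<psi> = foldr partial_deriv is \<phi>"
    define \<gamma> where "\<gamma> = \<beta>(i := Suc (\<beta> i))"
    have shift: "\<gamma> j + count_list is j = \<beta> j + count_list (i # is) j" for j
      by (simp add: \<gamma>_def)
    have \<gamma>: "\<gamma> \<le> \<alpha>" "\<beta> \<le> \<alpha>"
      using Cons.prems shift by (auto simp: le_fun_def intro: order_trans[OF le_add1] simp del: count_list.simps)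
         (metis add_leE)+
    have "(LINT x|lborel. U \<beta> x * partial_deriv i \<psi> x) = - (LINT x|lborel. U \<gamma> x * \<psi> x)"
    proof (rule integration_by_parts_partial)
      show "\<psi> differentiable (at x)" for x
        using \<phi> by (simp add: \<psi>_def test_functions_def)
      show "continuous_on UNIV (partial_deriv i \<psi>)"
        using test_function_derivs_continuous[OF \<phi>, of "i # is"] by (simp add: \<psi>_def)
      show "compact (closure {x. \<phi> x \<noteq> 0})"
        using \<phi> by (simp add: test_functions_def)
      show "\<psi> x = 0" "partial_deriv i \<psi> x = 0" if "x \<notin> closure {x. \<phi> x \<noteq> 0}" for x
        using foldr_partial_deriv_outside_support[OF that, of "is"]
          foldr_partial_deriv_outside_support[OF that, of "i # is"] by (simp_all add: \<psi>_def)
      show "((\<lambda>t. U \<beta> (x + t *\<^sub>R axis i 1)) has_real_derivative U \<gamma> x) (at 0)" for x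
        using deriv \<gamma>(1) unfolding \<gamma>_def by blast
    qed (use cont \<gamma> in auto)
    also have "(LINT x|lborel. U \<gamma> x * \<psi> x) =
        (-1) ^ length is * (LINT x|lborel. U (\<lambda>j. \<gamma> j + count_list is j) x * \<phi> x)"
      unfolding \<psi>_def by (rule Cons.IH) (use Cons.prems shift in metis)
    finally show ?case by (simp add: \<psi>_def shift)
  qed simp
  define L where "L = (SOME is. \<forall>i. count_list is i = \<alpha> i)"
  have L: "count_list L i = \<alpha> i" for i
    using someI_ex[OF exists_list_with_counts[of \<alpha>]] by (auto simp: L_def)
  have len: "length L = mi_abs \<alpha>"
    using sum_count_set[of L UNIV] by (simp add: mi_abs_def L)
  have lebesgue: "(LINT x|lebesgue_on \<Omega>. U \<beta> x * foldr partial_deriv is \<phi> x) =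
      (LINT x|lborel. U \<beta> x * foldr partial_deriv is \<phi> x)"
    if "\<beta> \<le> \<alpha>" "\<phi> \<in> test_functions \<Omega>" for \<beta> \<phi> "is"
  proof (rule lebesgue_on_integral_of_continuous[OF \<Omega>])
    show "continuous_on UNIV (\<lambda>x. U \<beta> x * foldr partial_deriv is \<phi> x)"
      by (intro continuous_intros cont test_function_derivs_continuous[where \<Omega> = \<Omega>] that)
    show "U \<beta> x * foldr partial_deriv is \<phi> x = 0" if "x \<notin> \<Omega>" for x
      using foldr_partial_deriv_outside_support[of x \<phi> "is"] that \<open>\<phi> \<in> test_functions \<Omega>\<close>
      by (auto simp: test_functions_def)
  qed
  have "(LINT x|lebesgue_on \<Omega>. U (\<lambda>_. 0) x * multi_deriv \<alpha> \<phi> x) =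
        (-1) ^ mi_abs \<alpha> * (LINT x|lebesgue_on \<Omega>. U \<alpha> x * \<phi> x)" if \<phi>: "\<phi> \<in> test_functions \<Omega>" for \<phi>
    unfolding multi_deriv_def L_def[symmetric]
    using *[OF \<phi>, of "\<lambda>_. 0" L] lebesgue[OF _ \<phi>, of "\<lambda>_. 0" L] lebesgue[OF _ \<phi>, of \<alpha> "[]"]
    by (simp add: L len le_fun_def)
  then show ?thesis
    unfolding is_weak_deriv_def
    by (auto intro!: continuous_imp_locally_integrable_on cont simp: le_fun_def)
qed

lemma classical_imp_sobolev:
  fixes U :: "('n::finite \<Rightarrow> nat) \<Rightarrow> real^'n \<Rightarrow> real"
  assumes \<Omega>: "open \<Omega>" "bounded \<Omega>" and A: "coherent A" and p: "p > 0"
    and cont: "\<And>\<beta>. \<beta> \<in> A \<Longrightarrow> continuous_on UNIV (U \<beta>)"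
    and deriv: "\<And>\<beta> i x. \<beta>(i := Suc (\<beta> i)) \<in> A \<Longrightarrow>
      ((\<lambda>t. U \<beta> (x + t *\<^sub>R axis i 1)) has_real_derivative U (\<beta>(i := Suc (\<beta> i))) x) (at 0)"
  shows "U (\<lambda>_. 0) \<in> sobolev \<Omega> A p"
proof -
  have down: "\<beta> \<in> A" if "\<alpha> \<in> A" "\<beta> \<le> \<alpha>" for \<alpha> \<beta>
    using A that by (auto simp: coherent_def)
  have zero: "(\<lambda>_. 0) \<in> A"
    using A down by (auto simp: coherent_def le_fun_def)
  have meas: "U \<beta> \<in> borel_measurable (lebesgue_on \<Omega>)" if "\<beta> \<in> A" for \<beta>
    using continuous_imp_integrable_lebesgue_on_bounded[OF \<Omega> cont[OF that]] by simp
  have "U \<alpha> \<in> Lp_functions \<Omega> p" if "\<alpha> \<in> A" for \<alpha>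
  proof -
    have "continuous_on UNIV (\<lambda>x. \<bar>U \<alpha> x\<bar> powr p)"
      using p by (intro continuous_on_powr' continuous_intros cont that) auto
    then show ?thesis
      unfolding Lp_functions_def
      using meas[OF that] continuous_imp_integrable_lebesgue_on_bounded[OF \<Omega>] by auto
  qed
  moreover have "is_weak_deriv \<Omega> \<alpha> (U (\<lambda>_. 0)) (U \<alpha>)" if "\<alpha> \<in> A" for \<alpha>
    by (rule is_weak_deriv_classical[OF \<Omega>(1)]) (use down[OF that] cont deriv in blast)+
  ultimately show ?thesis
    using meas[OF zero] by (auto simp: sobolev_def)
qed

section \<open>Functions with continuous derivatives indexed by a set of multi-indices\<close>

text \<open>
  A function of class \<open>C\<^sup>A\<close> supported in \<open>S\<close>, given by all its derivatives \<open>U \<beta> = \<partial>\<^sub>\<beta> (U 0)\<close> at once.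
  Carrying the derivatives along makes the closure properties below termwise statements.
\<close>

definition jet :: "('n::finite \<Rightarrow> nat) set \<Rightarrow> (real^'n) set \<Rightarrow> (('n \<Rightarrow> nat) \<Rightarrow> real^'n \<Rightarrow> real) \<Rightarrow> bool"
  where "jet A S U \<longleftrightarrow>
    (\<forall>\<beta>\<in>A. continuous_on UNIV (U \<beta>) \<and> (\<forall>x. x \<notin> S \<longrightarrow> U \<beta> x = 0)) \<and>
    (\<forall>\<beta> i x. \<beta> \<in> A \<and> \<beta>(i := Suc (\<beta> i)) \<in> A \<longrightarrow>
      ((\<lambda>t. U \<beta> (x + t *\<^sub>R axis i 1)) has_real_derivative U (\<beta>(i := Suc (\<beta> i))) x) (at 0))"

lemma jet_continuous: "jet A S U \<Longrightarrow> \<beta> \<in> A \<Longrightarrow> continuous_on UNIV (U \<beta>)"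
  and jet_support: "jet A S U \<Longrightarrow> \<beta> \<in> A \<Longrightarrow> x \<notin> S \<Longrightarrow> U \<beta> x = 0"
  and jet_deriv: "jet A S U \<Longrightarrow> \<beta> \<in> A \<Longrightarrow> \<beta>(i := Suc (\<beta> i)) \<in> A \<Longrightarrow>
      ((\<lambda>t. U \<beta> (x + t *\<^sub>R axis i 1)) has_real_derivative U (\<beta>(i := Suc (\<beta> i))) x) (at 0)"
  by (auto simp: jet_def)

lemma jet_mono: "jet A S U \<Longrightarrow> S \<subseteq> S' \<Longrightarrow> jet A S' U"
  by (auto simp: jet_def)

lemma jet_cmult: "jet A S U \<Longrightarrow> jet A S (\<lambda>\<beta> x. c * U \<beta> x)"
  unfolding jet_def by (auto intro!: continuous_intros DERIV_cmult)

lemma jet_sum: "(\<And>c. c \<in> I \<Longrightarrow> jet A S (U c)) \<Longrightarrow> jet A S (\<lambda>\<beta> x. \<Sum>c\<in>I. U c \<beta> x)"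
  unfolding jet_def by (auto intro!: continuous_intros DERIV_sum sum.neutral)

lemma jet_series:
  fixes U :: "nat \<Rightarrow> ('n::finite \<Rightarrow> nat) \<Rightarrow> real^'n \<Rightarrow> real"
  assumes U: "\<And>k. jet A S (U k)"
    and B: "\<And>k \<beta> x. \<beta> \<in> A \<Longrightarrow> \<bar>U k \<beta> x\<bar> \<le> B k" "summable B"
  shows "jet A S (\<lambda>\<beta> x. \<Sum>k. U k \<beta> x)"
proof -
  have summ: "summable (\<lambda>k. U k \<beta> x)" if "\<beta> \<in> A" for \<beta> x
    by (rule summable_comparison_test'[OF B(2), of 0]) (use B(1) that in auto)
  have unif: "uniform_limit UNIV (\<lambda>n x. \<Sum>k<n. U k \<beta> x) (\<lambda>x. \<Sum>k. U k \<beta> x) sequentially"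
    if "\<beta> \<in> A" for \<beta>
    by (rule Weierstrass_m_test[OF _ B(2)]) (use B(1) that in auto)
  have cont: "continuous_on UNIV (\<lambda>x. \<Sum>k. U k \<beta> x)" if "\<beta> \<in> A" for \<beta>
    by (rule uniform_limit_theorem[OF _ unif[OF that]])
       (auto intro!: always_eventually continuous_intros jet_continuous[OF U] that)
  have "((\<lambda>t. \<Sum>k. U k \<beta> (x + t *\<^sub>R axis i 1)) has_real_derivative (\<Sum>k. U k (\<beta>(i := Suc (\<beta> i))) x)) (at 0)"
    if \<beta>: "\<beta> \<in> A" "\<beta>(i := Suc (\<beta> i)) \<in> A" for \<beta> i x
  proof -
    let ?\<gamma> = "\<beta>(i := Suc (\<beta> i))"
    have deriv: "((\<lambda>t. U k \<beta> (x + t *\<^sub>R axis i 1)) has_real_derivative U k ?\<gamma> (x + s *\<^sub>R axis i 1)) (at s)" for k s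
    proof -
      have "((\<lambda>t. U k \<beta> ((x + s *\<^sub>R axis i 1) + t *\<^sub>R axis i 1)) has_real_derivative U k ?\<gamma> (x + s *\<^sub>R axis i 1)) (at (s - s))"
        using jet_deriv[OF U \<beta>] by simp
      then have "((\<lambda>u. U k \<beta> ((x + s *\<^sub>R axis i 1) + (u - s) *\<^sub>R axis i 1)) has_real_derivative
          U k ?\<gamma> (x + s *\<^sub>R axis i 1) * 1) (at s)"
        by (rule DERIV_chain2) (auto intro!: derivative_eq_intros)
      then show ?thesis by (simp add: algebra_simps)
    qed
    have "uniformly_convergent_on UNIV (\<lambda>n t. \<Sum>k<n. U k ?\<gamma> (x + t *\<^sub>R axis i 1))"
      by (rule Weierstrass_m_test'[OF _ B(2)]) (use B(1) \<beta> in auto)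
    then have "((\<lambda>t. \<Sum>k. U k \<beta> (x + t *\<^sub>R axis i 1)) has_real_derivative
        (\<Sum>k. U k ?\<gamma> (x + 0 *\<^sub>R axis i 1))) (at 0)"
      by (intro has_field_derivative_series'(2)[where S = UNIV and ?x0.0 = 0] deriv[THEN DERIV_subset] summ \<beta>)
         (auto simp del: fun_upd_apply)
    then show ?thesis by simp
  qed
  then show ?thesis
    using cont jet_support[OF U] by (auto simp: jet_def)
qed

lemma jet_imp_sobolev:
  assumes "open \<Omega>" "bounded \<Omega>" "coherent A" "p > 0" "jet A S U"
  shows "U (\<lambda>_. 0) \<in> sobolev \<Omega> A p"
proof (rule classical_imp_sobolev[OF assms(1-4)])
  fix \<beta> i x assume "\<beta>(i := Suc (\<beta> i)) \<in> A"
  moreover from this have "\<beta> \<in> A"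
    using assms(3) by (auto simp: coherent_def le_fun_def elim!: ballE[where x = "\<beta>(i := Suc (\<beta> i))"])
  ultimately show "((\<lambda>t. U \<beta> (x + t *\<^sub>R axis i 1)) has_real_derivative U (\<beta>(i := Suc (\<beta> i))) x) (at 0)"
    by (intro jet_deriv[OF assms(5)])
qed (use jet_continuous[OF assms(5)] in auto)

section \<open>Bump functions on small cubes\<close>

lemma DERIV_truncated_power:
  fixes x :: real
  assumes "a \<ge> 2"
  shows "((\<lambda>x. max 0 x ^ a) has_real_derivative real a * max 0 x ^ (a - 1)) (at x)"
proof -
  consider "x < 0" | "x > 0" | "x = 0" by linarith
  then show ?thesis
  proof cases
    case 1
    have "((\<lambda>x. 0) has_real_derivative real a * max 0 x ^ (a - 1)) (at x)"
      using 1 assms by (simp add: max_def zero_power)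
    then show ?thesis
      by (rule has_field_derivative_transform_within_open[where S = "{..<0}"])
         (use 1 assms in \<open>auto simp: max_def zero_power\<close>)
  next
    case 2
    have "((\<lambda>x. x ^ a) has_real_derivative real a * max 0 x ^ (a - 1)) (at x)"
      using 2 by (auto intro!: derivative_eq_intros simp: max_def)
    then show ?thesis
      by (rule has_field_derivative_transform_within_open[where S = "{0<..}"])
         (use 2 in \<open>auto simp: max_def\<close>)
  next
    case 3
    have "((\<lambda>h. max 0 h ^ a / h) \<longlongrightarrow> 0) (at (0::real))"
    proof (rule Lim_null_comparison)
      have "\<bar>max 0 h ^ a / h\<bar> \<le> \<bar>h\<bar>" if "\<bar>h\<bar> < 1" for h :: real
      proof (cases "h > 0")
        case True
        have "h ^ a \<le> h ^ 2"
          using True that assms by (intro power_decreasing) auto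
        then show ?thesis using True by (simp add: max_def field_simps power2_eq_square)
      next
        case False
        then show ?thesis using assms by (simp add: max_def zero_power)
      qed
      then show "\<forall>\<^sub>F h in at (0::real). norm (max 0 h ^ a / h) \<le> \<bar>h\<bar>"
        by (auto simp: eventually_at dist_real_def intro!: exI[of _ 1])
      show "((\<lambda>h. \<bar>h\<bar>) \<longlongrightarrow> 0) (at (0::real))"
        by (auto intro!: tendsto_eq_intros)
    qed
    then show ?thesis
      using 3 assms by (simp add: DERIV_def zero_power)
  qed
qed

text \<open>
  A bump of finite smoothness is enough, so truncated powers serve in place of \<open>exp (- 1 / x)\<close>. The
  derivative of the function with exponents \<open>a, b\<close> is a combination of those with exponents
  \<open>a - 1, b\<close> and \<open>a, b - 1\<close>, and therefore the induction on \<open>k\<close> is over all exponents above \<open>k\<close>.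
\<close>

lemma exists_truncated_power_derivs:
  fixes a b :: nat
  assumes "a > k" "b > k"
  shows "\<exists>D M. D 0 = (\<lambda>x::real. max 0 x ^ a * max 0 (1 - x) ^ b) \<and>
    (\<forall>j\<le>k. continuous_on UNIV (D j) \<and> (\<forall>x. \<bar>D j x\<bar> \<le> M) \<and> (\<forall>x. x \<notin> {0<..<1} \<longrightarrow> D j x = 0)) \<and>
    (\<forall>j<k. \<forall>x. (D j has_real_derivative D (Suc j) x) (at x))"
  using assms
proof (induction k arbitrary: a b)
  case 0
  let ?h = "\<lambda>x::real. max 0 x ^ a * max 0 (1 - x) ^ b"
  have zero: "?h x = 0" if "x \<notin> {0<..<1}" for x
    using that 0 by (auto simp: max_def zero_power)
  moreover have "\<bar>?h x\<bar> \<le> 1" for x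
  proof (cases "x \<in> {0<..<1}")
    case True
    then have "\<bar>?h x\<bar> \<le> 1 * 1"
      unfolding abs_mult by (intro mult_mono) (auto simp: max_def power_le_one)
    then show ?thesis by simp
  next
    case False
    show ?thesis by (simp only: zero[OF False] abs_zero zero_le_one)
  qed
  moreover have "continuous_on UNIV ?h" by (intro continuous_intros)
  ultimately show ?case by (intro exI[of _ "\<lambda>_. ?h"] exI[of _ 1]) auto
next
  case (Suc k)
  let ?h = "\<lambda>a b. \<lambda>x::real. max 0 x ^ a * max 0 (1 - x) ^ b"
  obtain D1 M1 where DM1: "D1 0 = ?h (a - 1) b \<and>
    (\<forall>j\<le>k. continuous_on UNIV (D1 j) \<and> (\<forall>x. \<bar>D1 j x\<bar> \<le> M1) \<and> (\<forall>x. x \<notin> {0<..<1} \<longrightarrow> D1 j x = 0)) \<and>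
    (\<forall>j<k. \<forall>x. (D1 j has_real_derivative D1 (Suc j) x) (at x))"
  proof -
    have "k < a - 1" "k < b" using Suc.prems by auto
    then show ?thesis using Suc.IH that by blast
  qed
  from DM1 have D1: "D1 0 = ?h (a - 1) b"
    "\<And>j. j \<le> k \<Longrightarrow> continuous_on UNIV (D1 j)" "\<And>j x. j \<le> k \<Longrightarrow> \<bar>D1 j x\<bar> \<le> M1"
    "\<And>j x. j \<le> k \<Longrightarrow> x \<notin> {0<..<1} \<Longrightarrow> D1 j x = 0"
    "\<And>j x. j < k \<Longrightarrow> (D1 j has_real_derivative D1 (Suc j) x) (at x)"
    by blast+
  obtain D2 M2 where DM2: "D2 0 = ?h a (b - 1) \<and>
    (\<forall>j\<le>k. continuous_on UNIV (D2 j) \<and> (\<forall>x. \<bar>D2 j x\<bar> \<le> M2) \<and> (\<forall>x. x \<notin> {0<..<1} \<longrightarrow> D2 j x = 0)) \<and>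
    (\<forall>j<k. \<forall>x. (D2 j has_real_derivative D2 (Suc j) x) (at x))"
  proof -
    have "k < a" "k < b - 1" using Suc.prems by auto
    then show ?thesis using Suc.IH that by blast
  qed
  from DM2 have D2: "D2 0 = ?h a (b - 1)"
    "\<And>j. j \<le> k \<Longrightarrow> continuous_on UNIV (D2 j)" "\<And>j x. j \<le> k \<Longrightarrow> \<bar>D2 j x\<bar> \<le> M2"
    "\<And>j x. j \<le> k \<Longrightarrow> x \<notin> {0<..<1} \<Longrightarrow> D2 j x = 0"
    "\<And>j x. j < k \<Longrightarrow> (D2 j has_real_derivative D2 (Suc j) x) (at x)"
    by blast+
  define D where "D j = (case j of 0 \<Rightarrow> ?h a b | Suc j \<Rightarrow> (\<lambda>x. real a * D1 j x - real b * D2 j x))" for j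
  have D0: "D 0 = ?h a b" and DS: "D (Suc j) = (\<lambda>x. real a * D1 j x - real b * D2 j x)" for j
    by (simp_all add: D_def)
  have "(?h a b has_real_derivative real a * ?h (a - 1) b x - real b * ?h a (b - 1) x) (at x)" for x
  proof -
    have "((\<lambda>x. max 0 (1 - x) ^ b) has_real_derivative real b * max 0 (1 - x) ^ (b - 1) * (-1)) (at x)"
      by (rule DERIV_chain2[OF DERIV_truncated_power]) (use Suc.prems in \<open>auto intro!: derivative_eq_intros\<close>)
    moreover have "((\<lambda>x. max 0 x ^ a) has_real_derivative real a * max 0 x ^ (a - 1)) (at x)"
      by (rule DERIV_truncated_power) (use Suc.prems in auto)
    ultimately show ?thesis
      using DERIV_mult by (fastforce simp: algebra_simps)
  qed
  then have "(D 0 has_real_derivative D (Suc 0) x) (at x)" for x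
    by (simp add: D0 DS D1(1) D2(1))
  moreover have "(D (Suc j) has_real_derivative D (Suc (Suc j)) x) (at x)" if "j < k" for j x
    unfolding DS by (intro DERIV_diff DERIV_cmult D1(5) D2(5) that)
  ultimately have der: "(D j has_real_derivative D (Suc j) x) (at x)" if "j < Suc k" for j x
    using that by (cases j) auto
  have cont: "continuous_on UNIV (D j)" if "j \<le> Suc k" for j
    using that D1(2) D2(2) by (cases j) (auto simp: D0 DS intro!: continuous_intros)
  have zero: "D j x = 0" if "j \<le> Suc k" "x \<notin> {0<..<1}" for j x
    using that D1(4)[of "j - 1" x] D2(4)[of "j - 1" x] Suc.prems
    by (cases j) (auto simp: D0 DS max_def zero_power)
  have bound: "\<bar>D j x\<bar> \<le> max 1 (real a * M1 + real b * M2)" if "j \<le> Suc k" for j x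
  proof (cases j)
    case 0
    show ?thesis
    proof (cases "x \<in> {0<..<1}")
      case True
      then have "\<bar>?h a b x\<bar> \<le> 1 * 1"
        unfolding abs_mult by (intro mult_mono) (auto simp: max_def power_le_one)
      then show ?thesis by (simp add: 0 D0)
    next
      case False
      then show ?thesis using zero[OF that] by simp
    qed
  next
    case (Suc i)
    then have "i \<le> k" using that by simp
    have "\<bar>D j x\<bar> \<le> \<bar>real a * D1 i x\<bar> + \<bar>real b * D2 i x\<bar>"
      unfolding Suc DS by (rule abs_triangle_ineq4)
    also have "\<dots> \<le> real a * M1 + real b * M2"
      using D1(3) D2(3) \<open>i \<le> k\<close> by (auto simp: abs_mult intro!: add_mono mult_left_mono)
    finally show ?thesis by simp
  qed
  show ?case
    by (intro exI[of _ D] exI[of _ "max 1 (real a * M1 + real b * M2)"]) (use D0 der cont zero bound in auto)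
qed

text \<open>
  A one-dimensional bump of class \<open>C\<^sup>m\<close> on the unit interval with its derivatives \<open>D j\<close>, which is at
  least \<open>b\<close> on the middle half.
\<close>

locale bump =
  fixes m :: nat and D :: "nat \<Rightarrow> real \<Rightarrow> real" and M b :: real
  assumes D_continuous: "j \<le> m \<Longrightarrow> continuous_on UNIV (D j)"
    and D_bound: "j \<le> m \<Longrightarrow> \<bar>D j x\<bar> \<le> M" and M_ge_1: "M \<ge> 1"
    and D_support: "j \<le> m \<Longrightarrow> D j x \<noteq> 0 \<Longrightarrow> 0 < x \<and> x < 1"
    and D_deriv: "j < m \<Longrightarrow> (D j has_real_derivative D (Suc j) x) (at x)"
    and b_pos: "b > 0" and D_ge: "1/4 \<le> x \<Longrightarrow> x \<le> 3/4 \<Longrightarrow> D 0 x \<ge> b"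

lemma exists_bump:
  obtains D M b where "bump m D M b"
proof -
  obtain D M where DM: "D 0 = (\<lambda>x::real. max 0 x ^ Suc m * max 0 (1 - x) ^ Suc m) \<and>
    (\<forall>j\<le>m. continuous_on UNIV (D j) \<and> (\<forall>x. \<bar>D j x\<bar> \<le> M) \<and> (\<forall>x. x \<notin> {0<..<1} \<longrightarrow> D j x = 0)) \<and>
    (\<forall>j<m. \<forall>x. (D j has_real_derivative D (Suc j) x) (at x))"
    using exists_truncated_power_derivs[OF lessI lessI] by blast
  then have D: "D 0 = (\<lambda>x::real. max 0 x ^ Suc m * max 0 (1 - x) ^ Suc m)"
    "\<And>j. j \<le> m \<Longrightarrow> continuous_on UNIV (D j)" "\<And>j x. j \<le> m \<Longrightarrow> \<bar>D j x\<bar> \<le> M"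
    "\<And>j x. j \<le> m \<Longrightarrow> x \<notin> {0<..<1} \<Longrightarrow> D j x = 0"
    "\<And>j x. j < m \<Longrightarrow> (D j has_real_derivative D (Suc j) x) (at x)"
    by blast+
  have "bump m D (max 1 M) ((1/4) ^ Suc m * (1/4) ^ Suc m)"
  proof
    show "D 0 x \<ge> (1/4) ^ Suc m * (1/4) ^ Suc m" if "1/4 \<le> x" "x \<le> 3/4" for x
      unfolding D(1) by (intro mult_mono power_mono) (use that in \<open>auto simp: max_def\<close>)
    show "0 < x \<and> x < 1" if "j \<le> m" "D j x \<noteq> 0" for j x
      using D(4)[OF that(1), of x] that(2) by auto
  qed (use D in \<open>auto simp: le_max_iff_disj\<close>)
  then show thesis by (rule that)
qed

text \<open>
  The derivative \<open>\<partial>\<^sub>\<beta>\<close> of the product of one-dimensional bumps, placed on the cube number \<open>c\<close> of the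
  grid with origin \<open>q\<close> and mesh size \<open>1/\<kappa>\<close>. The chain rule gives the powers of \<open>\<kappa>\<close>.
\<close>

definition box_bump :: "(nat \<Rightarrow> real \<Rightarrow> real) \<Rightarrow> real \<Rightarrow> real^'n::finite \<Rightarrow> ('n \<Rightarrow> nat) \<Rightarrow> ('n \<Rightarrow> nat) \<Rightarrow> real^'n \<Rightarrow> real"
  where "box_bump D \<kappa> q c \<beta> x = (\<Prod>i\<in>UNIV. \<kappa> ^ \<beta> i * D (\<beta> i) (\<kappa> * (x $ i - q $ i) - real (c i)))"

context bump
begin

lemma box_bump_support:
  assumes "box_bump D \<kappa> q c \<beta> x \<noteq> 0" "\<And>i. \<beta> i \<le> m"
  shows "real (c i) < \<kappa> * (x $ i - q $ i)" "\<kappa> * (x $ i - q $ i) < real (c i) + 1"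
proof -
  have "D (\<beta> i) (\<kappa> * (x $ i - q $ i) - real (c i)) \<noteq> 0"
    using assms(1) by (auto simp: box_bump_def)
  then show "real (c i) < \<kappa> * (x $ i - q $ i)" "\<kappa> * (x $ i - q $ i) < real (c i) + 1"
    using D_support[OF assms(2)[of i]] by fastforce+
qed

lemma box_bump_bound:
  assumes "\<kappa> \<ge> 0" "\<And>i. \<beta> i \<le> m"
  shows "\<bar>box_bump D \<kappa> q c \<beta> (x :: real^'n::finite)\<bar> \<le> \<kappa> ^ mi_abs \<beta> * M ^ CARD('n)"
proof -
  have "\<bar>box_bump D \<kappa> q c \<beta> x\<bar> \<le> (\<Prod>i\<in>(UNIV :: 'n set). \<kappa> ^ \<beta> i * M)"
    unfolding box_bump_def abs_prod
    by (intro prod_mono) (use assms D_bound in \<open>auto simp: abs_mult intro!: mult_left_mono\<close>)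
  then show ?thesis by (simp add: prod.distrib mi_abs_def power_sum)
qed

lemma box_bump_jet:
  fixes q :: "real^'n::finite"
  assumes \<kappa>: "\<kappa> > 0" and A: "\<And>\<beta> i. \<beta> \<in> A \<Longrightarrow> \<beta> i \<le> m" and c: "\<And>i. real (c i) + 1 \<le> N"
  shows "jet A {x. \<forall>i. q $ i < x $ i \<and> x $ i < q $ i + N / \<kappa>} (box_bump D \<kappa> q c)"
proof -
  have "continuous_on UNIV (box_bump D \<kappa> q c \<beta>)" if "\<beta> \<in> A" for \<beta>
    unfolding box_bump_def
    by (intro continuous_intros continuous_on_compose2[OF D_continuous[OF A[OF that]]]) auto
  moreover have "box_bump D \<kappa> q c \<beta> x = 0"
    if \<beta>: "\<beta> \<in> A" and x: "x \<notin> {x. \<forall>i. q $ i < x $ i \<and> x $ i < q $ i + N / \<kappa>}" for \<beta> x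
  proof (rule ccontr)
    assume nz: "box_bump D \<kappa> q c \<beta> x \<noteq> 0"
    have "q $ i < x $ i \<and> x $ i < q $ i + N / \<kappa>" for i
    proof -
      note b = box_bump_support[OF nz A[OF \<beta>], of i]
      have "0 < \<kappa> * (x $ i - q $ i)" "\<kappa> * (x $ i - q $ i) < N"
        using b c[of i] by linarith+
      then have "0 < x $ i - q $ i" "x $ i - q $ i < N / \<kappa>"
        using \<kappa> by (simp_all add: zero_less_mult_iff pos_less_divide_eq mult.commute)
      then show ?thesis by linarith
    qed
    then show False using x by simp
  qed
  moreover have "((\<lambda>t. box_bump D \<kappa> q c \<beta> (x + t *\<^sub>R axis i 1)) has_real_derivative
      box_bump D \<kappa> q c (\<beta>(i := Suc (\<beta> i))) x) (at 0)"
    if \<beta>: "\<beta> \<in> A" "\<beta>(i := Suc (\<beta> i)) \<in> A" for \<beta> i x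
  proof -
    define F where "F j = \<kappa> ^ \<beta> j * D (\<beta> j) (\<kappa> * (x $ j - q $ j) - real (c j))" for j
    define z where "z = \<kappa> * (x $ i - q $ i) - real (c i)"
    have "\<beta> i < m" using A[OF \<beta>(2), of i] by simp
    have "box_bump D \<kappa> q c \<beta> (x + t *\<^sub>R axis i 1) = \<kappa> ^ \<beta> i * D (\<beta> i) (z + \<kappa> * t) * (\<Prod>j\<in>UNIV - {i}. F j)" for t
      unfolding box_bump_def
      by (subst prod.remove[of UNIV i]) (auto simp: axis_def F_def z_def algebra_simps intro!: prod.cong)
    moreover have "box_bump D \<kappa> q c (\<beta>(i := Suc (\<beta> i))) x =
        \<kappa> ^ \<beta> i * (D (Suc (\<beta> i)) z * \<kappa>) * (\<Prod>j\<in>UNIV - {i}. F j)"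
      unfolding box_bump_def
      by (subst prod.remove[of UNIV i]) (auto simp: F_def z_def intro!: prod.cong)
    moreover have "((\<lambda>t. D (\<beta> i) (z + \<kappa> * t)) has_real_derivative D (Suc (\<beta> i)) z * \<kappa>) (at 0)"
    proof (rule DERIV_chain2[where f = "D (\<beta> i)" and g = "\<lambda>t. z + \<kappa> * t"])
      show "(D (\<beta> i) has_real_derivative D (Suc (\<beta> i)) z) (at (z + \<kappa> * 0))"
        using D_deriv[OF \<open>\<beta> i < m\<close>] by simp
    qed (auto intro!: derivative_eq_intros)
    ultimately show ?thesis
      by (simp only:) (intro DERIV_cmult DERIV_cmult_right)
  qed
  ultimately show ?thesis by (simp add: jet_def)
qed

text \<open>
  The cubes of the grid are disjoint, so that at most one summand is non-zero at \<open>x\<close>. Hence the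
  bound does not depend on the number of bumps.
\<close>

lemma box_bump_signed_sum_bound:
  fixes x q :: "real^'n::finite"
  assumes "\<kappa> \<ge> 0" "\<And>i. \<beta> i \<le> m" "\<And>c. \<bar>\<epsilon> c\<bar> = 1"
  shows "\<bar>\<Sum>c\<in>I. \<epsilon> c * box_bump D \<kappa> q c \<beta> x\<bar> \<le> \<kappa> ^ mi_abs \<beta> * M ^ CARD('n)"
proof (cases "finite I")
  case True
  define c0 where "c0 i = nat \<lfloor>\<kappa> * (x $ i - q $ i)\<rfloor>" for i
  have "c = c0" if "box_bump D \<kappa> q c \<beta> x \<noteq> 0" for c
  proof
    fix i
    have "\<lfloor>\<kappa> * (x $ i - q $ i)\<rfloor> = int (c i)"
      using box_bump_support[OF that assms(2), of i] by (intro floor_unique) auto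
    then show "c i = c0 i" by (simp add: c0_def)
  qed
  then have "(\<Sum>c\<in>I. \<epsilon> c * box_bump D \<kappa> q c \<beta> x) = (\<Sum>c\<in>I \<inter> {c0}. \<epsilon> c * box_bump D \<kappa> q c \<beta> x)"
    using True by (intro sum.mono_neutral_right) auto
  also have "\<bar>\<dots>\<bar> \<le> \<kappa> ^ mi_abs \<beta> * M ^ CARD('n)"
    using box_bump_bound[OF assms(1,2), where q = q and c = c0 and x = x] assms(1,3) M_ge_1
    by (cases "c0 \<in> I") (auto simp: abs_mult)
  finally show ?thesis .
qed (use assms M_ge_1 in auto)

end

section \<open>The lower bound for the smoothness\<close>

text \<open>
  The bounded continuous functions on \<open>\<real>\<close> serve below as a Banach space of coefficients: their
  values at the naturals are bounded sequences, among them all unit sequences.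
\<close>

instance bcontfun :: (metric_space, banach) banach ..

text \<open>
  The counting argument with \<open>n\<^sup>d\<close> bumps, where \<open>n = 16\<^sup>k\<close>. The Hilbert norms of the signed sums are
  at least a multiple of \<open>n powr (d / 2)\<close> by the choice of signs and at most a multiple of
  \<open>n\<^sup>s * 2\<^sup>k\<close> by the closed graph theorem.
\<close>

lemma rkhs_smoothness_lower_bound:
  fixes \<Omega> :: "(real^'n::finite) set"
  assumes H: "rkhs \<Omega> H ip" and \<Omega>: "open \<Omega>" "\<Omega> \<noteq> {}" and A: "coherent A"
    and jets: "\<And>U. jet A \<Omega> U \<Longrightarrow> bounded (range (U (\<lambda>_. 0))) \<Longrightarrow> U (\<lambda>_. 0) \<in> H"
    and s: "\<And>\<beta>. \<beta> \<in> A \<Longrightarrow> mi_abs \<beta> \<le> s"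
  shows "CARD('n) \<le> 2 * s"
proof (rule ccontr)
  assume "\<not> CARD('n) \<le> 2 * s"
  define d where "d = CARD('n)"
  have d: "2 * s + 1 \<le> d" using \<open>\<not> CARD('n) \<le> 2 * s\<close> by (simp add: d_def)
  interpret rkhs \<Omega> H ip by (rule H)
  have A0: "(\<lambda>_. 0) \<in> A"
    using A by (auto simp: coherent_def le_fun_def)
  have A_le: "\<beta> i \<le> s" if "\<beta> \<in> A" for \<beta> i
    using s[OF that] member_le_sum[of i UNIV \<beta>] by (simp add: mi_abs_def)

  define E where "E N = {x \<in> \<Omega>. \<forall>f\<in>H. \<bar>f x\<bar> \<le> real N * ip_norm f}" for N
  have "\<Omega> \<subseteq> (\<Union>N. E N)"
  proof
    fix x assume "x \<in> \<Omega>"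
    then obtain C where C: "\<And>f. f \<in> H \<Longrightarrow> \<bar>f x\<bar> \<le> C * ip_norm f"
      using evaluation_bounded by blast
    obtain N where "C \<le> real N" using real_arch_simple by blast
    then have "\<bar>f x\<bar> \<le> real N * ip_norm f" if "f \<in> H" for f
      using C[OF that] mult_right_mono[OF _ ip_norm_nonneg[OF that], of C "real N"] by linarith
    then show "x \<in> (\<Union>N. E N)" using \<open>x \<in> \<Omega>\<close> by (auto simp: E_def)
  qed
  then obtain N x0 \<rho> where \<rho>: "\<rho> > 0" "ball x0 \<rho> \<subseteq> \<Omega>" "ball x0 \<rho> \<subseteq> closure (E N)"
    using Baire_cover_dense_in_ball[OF \<Omega>] by metis

  \<comment> \<open>a cube of side \<open>r\<close> that fits into the ball; \<open>r \<le> 1\<close> makes the inverse mesh sizes \<open>\<kappa> k\<close> at least 1\<close>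
  define r where "r = min 1 (\<rho> / (real d + 1))"
  have r: "0 < r" "r \<le> 1" using \<rho>(1) by (auto simp: r_def)
  define Q where "Q = {x. \<forall>i. x0 $ i < x $ i \<and> x $ i < x0 $ i + r}"
  have Q_ball: "Q \<subseteq> ball x0 \<rho>"
  proof
    fix x assume x: "x \<in> Q"
    have "norm (x - x0) \<le> (\<Sum>i\<in>UNIV. \<bar>(x - x0) $ i\<bar>)" by (rule norm_le_l1_cart)
    also have "\<dots> \<le> (\<Sum>i\<in>(UNIV::'n set). r)"
    proof (rule sum_mono)
      show "\<bar>(x - x0) $ i\<bar> \<le> r" for i
        using x by (auto simp: Q_def abs_le_iff dest!: spec[of _ i])
    qed
    also have "\<dots> = real d * r" by (simp add: d_def)
    also have "\<dots> \<le> real d * (\<rho> / (real d + 1))"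
      unfolding r_def by (intro mult_left_mono) auto
    also have "\<dots> < \<rho>" using \<rho>(1) by (simp add: field_simps)
    finally show "x \<in> ball x0 \<rho>" by (simp add: dist_norm norm_minus_commute)
  qed
  obtain D M b where "bump s D M b" by (rule exists_bump)
  then interpret bump s D M b .

  \<comment> \<open>\<open>Q\<close> is divided into \<open>16 ^ (k * d)\<close> cubes, indexed by \<open>I k\<close>, with one bump on each of them\<close>
  define \<kappa> where "\<kappa> k = 16 ^ k / r" for k :: nat
  have \<kappa>: "\<kappa> k \<ge> 1" for k
    using r order_trans[OF r(2) one_le_power[of "16::real" k]] by (simp add: \<kappa>_def le_divide_eq)
  define I where "I k = {c :: 'n \<Rightarrow> nat. \<forall>i. c i < 16 ^ k}" for k :: nat
  have I_eq: "I k = PiE UNIV (\<lambda>_. {..<16 ^ k})" for k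
    by (auto simp: I_def PiE_def)
  have fin_I: "finite (I k)" for k by (simp add: I_eq finite_PiE)
  have card_I: "card (I k) = 16 ^ (k * d)" for k
    by (simp add: I_eq card_PiE d_def power_mult)
  define f where "f k c = box_bump D (\<kappa> k) x0 c" for k and c :: "'n \<Rightarrow> nat"
  have f_jet: "jet A Q (f k c)" if "c \<in> I k" for k c
  proof -
    have "real (c i) + 1 \<le> 16 ^ k" for i
    proof -
      have "c i + 1 \<le> 16 ^ k" using that by (auto simp: I_def Suc_le_eq)
      then have "real (c i + 1) \<le> real (16 ^ k)" by (simp only: of_nat_le_iff)
      then show ?thesis by simp
    qed
    then have "jet A {x. \<forall>i. x0 $ i < x $ i \<and> x $ i < x0 $ i + 16 ^ k / \<kappa> k} (f k c)"
      unfolding f_def using A_le \<kappa>[of k] by (intro box_bump_jet) auto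
    then show ?thesis using r by (simp add: Q_def \<kappa>_def)
  qed
  have in_H: "U (\<lambda>_. 0) \<in> H" if "jet A Q U" "\<And>x. \<bar>U (\<lambda>_. 0) x\<bar> \<le> B" for U B
  proof (rule jets[of U])
    show "jet A \<Omega> U" by (rule jet_mono[OF that(1) order_trans[OF Q_ball \<rho>(2)]])
    show "bounded (range (U (\<lambda>_. 0)))" using that(2) by (auto intro!: boundedI)
  qed
  have f_H: "f k c (\<lambda>_. 0) \<in> H" if "c \<in> I k" for k c
  proof (rule in_H[OF f_jet[OF that]])
    show "\<bar>f k c (\<lambda>_. 0) x\<bar> \<le> \<kappa> k ^ mi_abs (\<lambda>_::'n. 0) * M ^ CARD('n)" for x
      unfolding f_def using \<kappa>[of k] by (intro box_bump_bound) auto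
  qed

  \<comment> \<open>density of \<open>E N\<close> gives a point of \<open>E N\<close> in the middle part of the cube, where the bump is large\<close>
  have f_norm: "b ^ d \<le> real N * ip_norm (f k c (\<lambda>_. 0))" if c: "c \<in> I k" for k c
  proof -
    define V where "V = {x. \<forall>i\<in>UNIV. \<kappa> k * (x $ i - x0 $ i) - real (c i) \<in> {1/4<..<3/4}}"
    define y where "y = (\<chi> i. x0 $ i + (real (c i) + 1/2) / \<kappa> k)"
    have "open V"
      unfolding V_def Collect_ball_eq
      by (intro open_INT ballI) (auto intro!: open_Collect_conj open_Collect_less continuous_intros)
    moreover have y: "y \<in> V"
      using \<kappa>[of k] by (auto simp: V_def y_def)
    moreover have "y \<in> Q"
    proof -
      have "D 0 (1/2) \<noteq> 0" using D_ge[of "1/2"] b_pos by auto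
      then have "f k c (\<lambda>_. 0) y \<noteq> 0"
        using \<kappa>[of k] by (simp add: f_def box_bump_def y_def)
      then show ?thesis using jet_support[OF f_jet[OF c] A0] by blast
    qed
    then have "y \<in> closure (E N)" using Q_ball \<rho> by blast
    ultimately obtain z where z: "z \<in> V" "z \<in> E N"
      by (meson closure_iff_nhds_not_empty disjoint_iff open_subset_interior subset_refl interior_subset)
    have "b ^ d \<le> f k c (\<lambda>_. 0) z"
    proof -
      have "(\<Prod>i\<in>(UNIV::'n set). b) \<le> (\<Prod>i\<in>UNIV. D 0 (\<kappa> k * (z $ i - x0 $ i) - real (c i)))"
      proof (rule prod_mono)
        fix i
        have "\<kappa> k * (z $ i - x0 $ i) - real (c i) \<in> {1/4<..<3/4}"
          using z(1) unfolding V_def by blast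
        then show "0 \<le> b \<and> b \<le> D 0 (\<kappa> k * (z $ i - x0 $ i) - real (c i))"
          using b_pos by (intro conjI D_ge) auto
      qed
      then show ?thesis by (simp add: f_def box_bump_def d_def)
    qed
    also have "\<dots> \<le> real N * ip_norm (f k c (\<lambda>_. 0))"
      using z(2) f_H[OF c] by (force simp: E_def)
    finally show ?thesis .
  qed
  define \<eta> where "\<eta> = (b ^ d / real N)\<^sup>2"
  have "N > 0"
  proof (rule ccontr)
    assume "\<not> N > 0"
    moreover have "(\<lambda>_. 0) \<in> I 0" by (simp add: I_def)
    ultimately have "b ^ d \<le> 0" using f_norm by force
    then show False using zero_less_power[OF b_pos, of d] by simp
  qed
  then have \<eta>: "\<eta> > 0" using b_pos by (simp add: \<eta>_def)
  have f_norm2: "\<eta> \<le> (ip_norm (f k c (\<lambda>_. 0)))\<^sup>2" if "c \<in> I k" for k c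
    unfolding \<eta>_def using f_norm[OF that] \<open>N > 0\<close> b_pos
    by (intro power_mono) (auto simp: field_simps)

  have "\<forall>k. \<exists>\<epsilon>. (\<forall>c. \<bar>\<epsilon> c :: real\<bar> = 1) \<and> (\<Sum>c\<in>I k. (ip_norm (f k c (\<lambda>_. 0)))\<^sup>2)
      \<le> (ip_norm (\<lambda>x. \<Sum>c\<in>I k. \<epsilon> c * f k c (\<lambda>_. 0) x))\<^sup>2"
  proof
    fix k
    obtain \<epsilon> :: "('n \<Rightarrow> nat) \<Rightarrow> real" where "\<And>c. \<bar>\<epsilon> c\<bar> = 1"
      "(\<Sum>c\<in>I k. (ip_norm (f k c (\<lambda>_. 0)))\<^sup>2) \<le> (ip_norm (\<lambda>x. \<Sum>c\<in>I k. \<epsilon> c * f k c (\<lambda>_. 0) x))\<^sup>2"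
      using exists_signs_ip_sum[of "I k" "\<lambda>c. f k c (\<lambda>_. 0)", OF fin_I f_H] by blast
    then show "\<exists>\<epsilon>. (\<forall>c. \<bar>\<epsilon> c :: real\<bar> = 1) \<and> (\<Sum>c\<in>I k. (ip_norm (f k c (\<lambda>_. 0)))\<^sup>2)
      \<le> (ip_norm (\<lambda>x. \<Sum>c\<in>I k. \<epsilon> c * f k c (\<lambda>_. 0) x))\<^sup>2"
      by blast
  qed
  then obtain \<epsilon> where signs: "\<forall>k. (\<forall>c. \<bar>\<epsilon> k c :: real\<bar> = 1) \<and>
      (\<Sum>c\<in>I k. (ip_norm (f k c (\<lambda>_. 0)))\<^sup>2) \<le> (ip_norm (\<lambda>x. \<Sum>c\<in>I k. \<epsilon> k c * f k c (\<lambda>_. 0) x))\<^sup>2"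
    by (rule choice[THEN exE])
  have \<epsilon>: "\<bar>\<epsilon> k c\<bar> = 1"
    "(\<Sum>c\<in>I k. (ip_norm (f k c (\<lambda>_. 0)))\<^sup>2) \<le> (ip_norm (\<lambda>x. \<Sum>c\<in>I k. \<epsilon> k c * f k c (\<lambda>_. 0) x))\<^sup>2" for k c
    using signs by blast+
  \<comment> \<open>the first factor of \<open>1 / a k\<close> normalises the derivatives of order up to \<open>s\<close>, the second one makes the series
    in \<open>T\<close> converge; base 16 lets the gain \<open>16 ^ k\<close> from \<open>2 * s + 1 \<le> d\<close> outweigh \<open>(2 ^ k)\<^sup>2\<close>\<close>
  define a :: "nat \<Rightarrow> real" where "a k = 1 / (16 ^ (k * s) * 2 ^ k)" for k
  have a_pos: "a k > 0" for k by (simp add: a_def)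
  define G where "G k \<beta> x = a k * (\<Sum>c\<in>I k. \<epsilon> k c * f k c \<beta> x)" for k \<beta> x
  define B where "B = M ^ d / r ^ s"
  have B: "B \<ge> 0" using M_ge_1 r by (simp add: B_def)
  have G_jet: "jet A Q (G k)" for k
    unfolding G_def by (intro jet_cmult jet_sum f_jet)
  have G_bound: "\<bar>G k \<beta> x\<bar> \<le> B * (1/2) ^ k" if "\<beta> \<in> A" for k \<beta> x
  proof -
    have "\<bar>\<Sum>c\<in>I k. \<epsilon> k c * f k c \<beta> x\<bar> \<le> \<kappa> k ^ mi_abs \<beta> * M ^ d"
      unfolding f_def d_def
      by (rule box_bump_signed_sum_bound) (use \<kappa>[of k] A_le[OF that] \<epsilon>(1) in auto)
    also have "\<dots> \<le> \<kappa> k ^ s * M ^ d"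
      using \<kappa> s[OF that] M_ge_1 by (intro mult_right_mono power_increasing) auto
    finally have "\<bar>G k \<beta> x\<bar> \<le> a k * (\<kappa> k ^ s * M ^ d)"
      unfolding G_def abs_mult using a_pos[of k] by (simp add: mult_left_mono)
    also have "\<dots> = B * (1/2) ^ k"
      by (simp add: a_def \<kappa>_def B_def power_divide power_mult)
    finally show ?thesis .
  qed

  \<comment> \<open>\<open>T\<close> depends on \<open>t\<close> only through the bounded sequence of its values at the naturals\<close>
  define T where "T t x = (\<Sum>k. apply_bcontfun t (real k) * G k (\<lambda>_. 0) x)" for t :: "real \<Rightarrow>\<^sub>C real" and x
  have geo: "summable (\<lambda>k. norm t * (B * (1/2) ^ k))" for t :: "real \<Rightarrow>\<^sub>C real"
    by (intro summable_mult summable_geometric) simp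
  have term_bound: "\<bar>apply_bcontfun t (real k) * G k \<beta> x\<bar> \<le> norm t * (B * (1/2) ^ k)" if "\<beta> \<in> A" for t k \<beta> x
    unfolding abs_mult using norm_bounded[of t "real k"] G_bound[OF that] by (intro mult_mono) auto
  have summ: "summable (\<lambda>k. apply_bcontfun t (real k) * G k (\<lambda>_. 0) x)" for t x
    by (rule summable_comparison_test'[OF geo[of t], of 0]) (use term_bound[OF A0] in auto)
  have T_bound: "\<bar>T t x\<bar> \<le> norm t * (B * 2)" for t x
  proof -
    have "norm (T t x) \<le> (\<Sum>k. norm t * (B * (1/2) ^ k))"
      unfolding T_def by (rule norm_suminf_le[OF _ geo]) (use term_bound[OF A0] in auto)
    also have "\<dots> = norm t * (B * 2)"
      using geometric_sums[of "1/2::real"] by (intro sums_unique[symmetric] sums_mult) simp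
    finally show ?thesis by simp
  qed
  have T_H: "T t \<in> H" for t
  proof -
    have "jet A Q (\<lambda>\<beta> x. \<Sum>k. apply_bcontfun t (real k) * G k \<beta> x)"
      by (rule jet_series[OF jet_cmult[OF G_jet] term_bound geo])
    then have "(\<lambda>x. \<Sum>k. apply_bcontfun t (real k) * G k (\<lambda>_. 0) x) \<in> H"
      by (rule in_H) (rule T_bound[of t, unfolded T_def])
    then show ?thesis by (simp add: T_def[abs_def])
  qed
  have T_linear: "bounded_linear (\<lambda>t. T t x)" for x
  proof (rule bounded_linear_intro)
    show "T (t + u) x = T t x + T u x" for t u
      unfolding T_def plus_bcontfun.rep_eq distrib_right by (intro suminf_add[symmetric] summ)
    show "T (c *\<^sub>R t) x = c *\<^sub>R T t x" for c t
      unfolding T_def scaleR_bcontfun.rep_eq real_scaleR_def mult.assoc by (intro suminf_mult summ)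
    show "norm (T t x) \<le> norm t * (B * 2)" for t using T_bound by simp
  qed
  obtain C where C: "\<And>t. ip_norm (T t) \<le> C * norm t"
    using closed_graph[of T, OF T_H T_linear] by blast
  have G_norm: "ip_norm (G k (\<lambda>_. 0)) \<le> \<bar>C\<bar>" for k
  proof -
    \<comment> \<open>the hat function at \<open>k\<close> is a bounded continuous function whose values at the
      naturals form the unit sequence at \<open>k\<close>\<close>
    define e where "e = Bcontfun (\<lambda>x. max 0 (1 - \<bar>x - real k\<bar>))"
    have e: "apply_bcontfun e = (\<lambda>x. max 0 (1 - \<bar>x - real k\<bar>))"
      unfolding e_def
      by (intro Bcontfun_inverse bcontfun_normI[where b = 1] continuous_intros) auto
    have e_nat: "apply_bcontfun e (real j) = (if j = k then 1 else 0)" for j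
    proof (cases "j = k")
      case False
      then have "\<bar>real j - real k\<bar> \<ge> 1" by linarith
      then show ?thesis using False by (simp add: e)
    qed (simp add: e)
    have "norm e \<le> 1" by (rule norm_bound) (simp add: e)
    then have "C * norm e \<le> \<bar>C\<bar> * 1" by (intro mult_mono) auto
    moreover have "T e x = G k (\<lambda>_. 0) x" for x
    proof -
      have "(\<lambda>j. apply_bcontfun e (real j) * G j (\<lambda>_. 0) x) = (\<lambda>j. if j = k then G j (\<lambda>_. 0) x else 0)"
        by (simp add: e_nat fun_eq_iff)
      then show ?thesis
        using sums_unique[OF sums_single[of k "\<lambda>j. G j (\<lambda>_. 0) x"]] by (simp add: T_def)
    qed
    then have "T e = G k (\<lambda>_. 0)" by auto
    ultimately show ?thesis using C[of e] by simp
  qed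
  have growth: "\<eta> * 4 ^ k \<le> C\<^sup>2" for k
  proof -
    let ?g = "\<lambda>x. \<Sum>c\<in>I k. \<epsilon> k c * f k c (\<lambda>_. 0) x"
    have g: "?g \<in> H" by (intro sum_closed scale_closed f_H)
    define W :: real where "W = (16 ^ (k * s) * 2 ^ k)\<^sup>2"
    have W: "W > 0" "(a k)\<^sup>2 = 1 / W" by (simp_all add: W_def a_def power_divide)
    have "(16::real) ^ k = (2 ^ k)\<^sup>2 * 4 ^ k"
      by (simp add: power2_eq_square flip: power_mult_distrib)
    then have "W * 4 ^ k = 16 ^ (k * s * 2) * 16 ^ k"
      by (simp only: W_def power_mult_distrib power_mult[of "16::real" "k * s" 2] mult.assoc[where ?'a = real])
    also have "\<dots> = 16 ^ (k * (2 * s + 1))"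
      by (simp add: algebra_simps flip: power_add)
    also have "\<dots> \<le> 16 ^ (k * d)"
      using d by (intro power_increasing mult_left_mono) auto
    finally have "4 ^ k \<le> (a k)\<^sup>2 * 16 ^ (k * d)"
      unfolding W(2) using W(1) by (simp add: pos_le_divide_eq mult.commute)
    then have "\<eta> * 4 ^ k \<le> \<eta> * ((a k)\<^sup>2 * 16 ^ (k * d))"
      using \<eta> by (intro mult_left_mono) auto
    also have "\<dots> = (a k)\<^sup>2 * (\<Sum>c\<in>I k. \<eta>)"
      by (simp add: card_I)
    also have "\<dots> \<le> (a k)\<^sup>2 * (ip_norm ?g)\<^sup>2"
      by (intro mult_left_mono order_trans[OF sum_mono[OF f_norm2] \<epsilon>(2)]) auto
    also have "\<dots> = (ip_norm (G k (\<lambda>_. 0)))\<^sup>2"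
      unfolding G_def ip_norm_scale[OF g] by (simp add: power_mult_distrib)
    also have "\<dots> \<le> \<bar>C\<bar>\<^sup>2"
      using G_norm ip_norm_nonneg[OF in_H[OF G_jet G_bound[OF A0]]] by (intro power_mono)
    finally show ?thesis by simp
  qed
  obtain k where "C\<^sup>2 / \<eta> < 4 ^ k" using real_arch_pow[of 4] by auto
  then show False using growth[of k] \<eta> by (simp add: field_simps)
qed

lemma cont_rep_eqI:
  assumes "sobolev_embeds \<Omega> A p" "f \<in> sobolev \<Omega> A p" "is_cont_rep \<Omega> f g"
  shows "cont_rep \<Omega> f = g"
  unfolding cont_rep_def using assms by (intro the1_equality) (auto simp: sobolev_embeds_def)

theorem theorem15:
  fixes \<Omega> :: "(real^'n::finite) set" and A :: "('n \<Rightarrow> nat) set" and p d s :: real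
  assumes d: "d = real CARD('n)"
    and \<Omega>: "open \<Omega>" "connected \<Omega>" "\<Omega> \<noteq> {}" "bounded \<Omega>"
    and A: "coherent A"
    and p: "1 \<le> p"
    and embedding: "sobolev_embeds \<Omega> A p"
    and s: "s = real (mi_set_abs A)"
    and "s \<ge> d / p"
    and "\<exists>H ip. rkhs \<Omega> H ip \<and> cont_rep \<Omega> ` sobolev \<Omega> A p \<subseteq> H \<and> H \<subseteq> ell_infty \<Omega>"
  shows "s \<ge> max 0 (d / p - d / 2) + d / 2"
proof -
  obtain H ip where H: "rkhs \<Omega> H ip" "cont_rep \<Omega> ` sobolev \<Omega> A p \<subseteq> H"
    using assms by blast
  have zero: "(\<lambda>_. 0) \<in> A"
    using A by (auto simp: coherent_def le_fun_def)
  have "CARD('n) \<le> 2 * mi_set_abs A"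
  proof (rule rkhs_smoothness_lower_bound[OF H(1) \<Omega>(1,3) A])
    show "mi_abs \<beta> \<le> mi_set_abs A" if "\<beta> \<in> A" for \<beta>
      using A that by (simp add: mi_set_abs_def coherent_def)
  next
    fix U assume U: "jet A \<Omega> U" "bounded (range (U (\<lambda>_. 0)))"
    let ?f = "U (\<lambda>_. 0)"
    have "?f \<in> sobolev \<Omega> A p"
      using \<Omega> A p U by (intro jet_imp_sobolev) auto
    moreover have "is_cont_rep \<Omega> ?f ?f"
      unfolding is_cont_rep_def ell_infty_def functions_on_def
      using U(2) jet_support[OF U(1) zero] jet_continuous[OF U(1) zero]
      by (auto intro: bounded_subset continuous_on_subset)
    ultimately show "?f \<in> H"
      using cont_rep_eqI[OF embedding] H(2) by (metis image_subset_iff)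
  qed
  then have "d / 2 \<le> s" using d s by simp
  then show ?thesis using \<open>s \<ge> d / p\<close> by simp
qed

end
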